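(* Let $k\geq 2$, $d\in\{2k,2k+1\}$, and let $\Delta$ be a $(d-1)$-dimensional nearly neighborly Eulerian complex with $n$ vertices. Then $$\begin{aligned} m_k(\Delta) \geq\;& \frac{k^2}{(k+1)\binom{n}{k-1}}f_{k-1}(\Delta)^2-\frac{n(k-1)-k(k-2)}{k+1}f_{k-1}(\Delta) \\ &-f_k(C(d,n))+\left(\lfloor d/2\rfloor+1+(-1)^{d-1}\right)\left(\binom{n}{k}-f_{k-1}(\Delta)\right).\end{aligned}$$
   Context: A simplicial complex $\Delta$ with (finite) vertex set $V$ is a non-empty collection of subsets (faces) of $V$ closed under inclusion and containing all singletons. An $i$-face is a face of size $i+1$ (dimension $i$). A missing $i$-face is a subset of $V$ of size $i+1$ that is not a face but all of whose proper subsets are faces. $f_i(\Delta)$ and $m_i(\Delta)$ denote the numbers of $i$-faces and missing $i$-faces of $\Delta$, respectively. The link of a face $F$ is $\mathrm{lk}(F,\Delta)=\{\sigma\in\Delta: \sigma\cup F\in\Delta,\ \sigma\cap F=\emptyset\}$. The reduced Euler characteristic is $\tilde\chi(\Delta)=\sum_{i=-1}^{\dim\Delta}(-1)^i f_i(\Delta)$. $\Delta$ is Eulerian if $\tilde\chi(\mathrm{lk}(F,\Delta))=(-1)^{\dim\Delta-\dim F-1}$ for every face $F$ of $\Delta$, including the empty face. $\Delta$ is $i$-neighborly if $f_{i-1}(\Delta)=\binom{f_0(\Delta)}{i}$. A $(d-1)$-dimensional Eulerian complex is nearly neighborly if it is $(\lfloor d/2\rfloor-1)$-neighborly. $C(d,n)$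 denotes the cyclic $d$-polytope with $n>d$ vertices, i.e., the convex hull of $n$ distinct points on the moment curve $t\mapsto(t,t^2,\dots,t^d)$ in $\mathbb{R}^d$ (its combinatorial type does not depend on the chosen points), and $f_k(C(d,n))$ is its number of $k$-dimensional proper faces. *)

theory Defs
  imports "HOL-Analysis.Analysis"
begin

definition simplicial_complex :: "'v set \<Rightarrow> 'v set set \<Rightarrow> bool" where
  "simplicial_complex V \<Delta> \<longleftrightarrow>
     finite V \<and> \<Delta> \<noteq> {} \<and> \<Delta> \<subseteq> Pow V \<and>
     (\<forall>F\<in>\<Delta>. \<forall>G. G \<subseteq> F \<longrightarrow> G \<in> \<Delta>) \<and> (\<forall>v\<in>V. {v} \<in> \<Delta>)"

text \<open>Dimensions are integers, since the empty face has dimension \<open>-1\<close>.\<close>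

definition face_dim :: "'v set \<Rightarrow> int" where
  "face_dim F = int (card F) - 1"

definition complex_dim :: "'v set set \<Rightarrow> int" where
  "complex_dim \<Delta> = Max (face_dim ` \<Delta>)"

definition num_faces :: "int \<Rightarrow> 'v set set \<Rightarrow> nat" where
  "num_faces i \<Delta> = card {F \<in> \<Delta>. face_dim F = i}"

definition missing_face :: "'v set \<Rightarrow> 'v set set \<Rightarrow> 'v set \<Rightarrow> bool" where
  "missing_face V \<Delta> S \<longleftrightarrow> S \<subseteq> V \<and> S \<notin> \<Delta> \<and> (\<forall>G. G \<subset> S \<longrightarrow> G \<in> \<Delta>)"

definition num_missing_faces :: "int \<Rightarrow> 'v set \<Rightarrow> 'v set set \<Rightarrow> nat" where
  "num_missing_faces i V \<Delta> = card {S. missing_face V \<Delta> S \<and> face_dim S = i}"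

definition face_link :: "'v set \<Rightarrow> 'v set set \<Rightarrow> 'v set set" where
  "face_link F \<Delta> = {\<sigma> \<in> \<Delta>. \<sigma> \<union> F \<in> \<Delta> \<and> \<sigma> \<inter> F = {}}"

text \<open>The signs are taken in the reals because the integer-exponent power \<open>powi\<close>
  is only available over division rings.\<close>

definition reduced_euler_char :: "'v set set \<Rightarrow> real" where
  "reduced_euler_char \<Delta> =
     (\<Sum>i = -1..complex_dim \<Delta>. (-1) powi i * real (num_faces i \<Delta>))"

definition eulerian :: "'v set set \<Rightarrow> bool" where
  "eulerian \<Delta> \<longleftrightarrow>
     (\<forall>F\<in>\<Delta>. reduced_euler_char (face_link F \<Delta>) =
              (-1) powi (complex_dim \<Delta> - face_dim F - 1))"

definition neighborly :: "nat \<Rightarrow> 'v set set \<Rightarrow> bool" where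
  "neighborly i \<Delta> \<longleftrightarrow> num_faces (int i - 1) \<Delta> = num_faces 0 \<Delta> choose i"

text \<open>With \<open>d = complex_dim \<Delta> + 1\<close>, this is \<open>(\<lfloor>d/2\<rfloor> - 1)\<close>-neighborliness;
  the subtraction on \<^typ>\<open>nat\<close> is meaningful for \<open>d \<ge> 2\<close>.\<close>

definition nearly_neighborly :: "'v set set \<Rightarrow> bool" where
  "nearly_neighborly \<Delta> \<longleftrightarrow>
     eulerian \<Delta> \<and> neighborly (nat (complex_dim \<Delta> + 1) div 2 - 1) \<Delta>"

text \<open>The coordinates of \<^typ>\<open>real ^ 'm\<close> are numbered \<open>1, \<dots>, CARD('m)\<close> along the linear
  order of the index type: \<open>card {..i}\<close> is the position of \<open>i\<close>. Hence
  \<open>moment_curve t = (t, t^2, \<dots>, t^CARD('m))\<close>.\<close>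

definition moment_curve :: "real \<Rightarrow> real ^ ('m::{finite,linorder})" where
  "moment_curve t = (\<chi> i. t ^ card {..i})"

definition cyclic_polytope :: "real set \<Rightarrow> (real ^ ('m::{finite,linorder})) set" where
  "cyclic_polytope T = convex hull (moment_curve ` T)"

definition num_polytope_faces :: "int \<Rightarrow> 'a::euclidean_space set \<Rightarrow> nat" where
  "num_polytope_faces i P = card {F. F face_of P \<and> F \<noteq> P \<and> aff_dim F = i}"

end

theory Submission
  imports Defs
begin

text \<open>
  Let \<open>f\<^sub>i\<close> be the number of \<open>i\<close>-faces. A set of size \<open>k + 1\<close> all of whose \<open>k\<close>-subsets are faces
  is either a face or a missing face, so \<open>m\<^sub>k\<close> is the number of such cliques minus \<open>f\<^sub>k\<close>.
  The cliques are bounded below as in de Caen's and Moon--Moser's arguments: count, for each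
  \<open>(k-1)\<close>-face, the one-point exchanges that stay in the complex, sum up and apply Cauchy--Schwarz
  to the degrees of the \<open>(k-1)\<close>-sets.

  The Dehn--Sommerville relations express \<open>f\<^sub>k\<close> through the deficiency
  \<open>\<delta> = (n choose k) - f\<^sub>k\<^sub>-\<^sub>1\<close>, since all smaller sets are faces; the coefficient of \<open>\<delta>\<close> is \<open>k\<close>
  for \<open>d = 2k\<close> and \<open>k + 2\<close> for \<open>d = 2k + 1\<close>.

  Only a lower bound for the number of \<open>k\<close>-faces of the cyclic polytope is required. A set of vertices
  spans a face as soon as it is the zero set, among the parameters, of a nonnegative polynomial of
  degree at most \<open>d\<close>. For \<open>k + 1\<close> vertices a product of squares has degree \<open>2k + 2\<close>, so it suffices
  to save two degrees for \<open>d = 2k\<close> (a cyclically consecutive pair) or one degree for \<open>d = 2k + 1\<close>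
  (a consecutive pair or an end vertex). The remaining sets have no two consecutive elements, and
  their number is exactly the Dehn--Sommerville defect of the binomial coefficient.
\<close>

section \<open>Cliques in uniform hypergraphs\<close>

lemma sum_card_incidence:
  assumes "finite A" "finite B"
  shows "(\<Sum>a\<in>A. card {b \<in> B. R a b}) = (\<Sum>b\<in>B. card {a \<in> A. R a b})"
  using sum.swap_restrict[OF assms, of "\<lambda>_ _. 1::nat" R] by simp

text \<open>Complete k-uniform subhypergraphs on k + 1 vertices; for k = 2 these are the triangles
  of a graph.\<close>

definition cliques :: "'v set \<Rightarrow> nat \<Rightarrow> 'v set set \<Rightarrow> 'v set set" where
  "cliques V k H = {S. S \<subseteq> V \<and> card S = Suc k \<and> (\<forall>e. e \<subseteq> S \<and> card e = k \<longrightarrow> e \<in> H)}"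

lemma card_subsets_one_less:
  assumes "finite e" "card e = k" "k \<ge> 1"
  shows "bij_betw (\<lambda>v. e - {v}) e {s. s \<subseteq> e \<and> card s = k - 1}"
proof (rule bij_betw_imageI)
  show "inj_on (\<lambda>v. e - {v}) e" by (auto simp: inj_on_def)
  show "(\<lambda>v. e - {v}) ` e = {s. s \<subseteq> e \<and> card s = k - 1}"
  proof
    show "(\<lambda>v. e - {v}) ` e \<subseteq> {s. s \<subseteq> e \<and> card s = k - 1}" using assms by auto
    show "{s. s \<subseteq> e \<and> card s = k - 1} \<subseteq> (\<lambda>v. e - {v}) ` e"
    proof
      fix s assume s: "s \<in> {s. s \<subseteq> e \<and> card s = k - 1}"
      then have "card (e - s) = 1"
        using assms finite_subset[of s e] by (auto simp: card_Diff_subset)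
      then obtain v where "e - s = {v}" by (auto simp: card_1_singleton_iff)
      with s have "v \<in> e" "s = e - {v}" by auto
      then show "s \<in> (\<lambda>v. e - {v}) ` e" by blast
    qed
  qed
qed

text \<open>Every vertex \<open>w\<close> outside \<open>e\<close> lies in at most \<open>k - 1\<close> of the exchanges
  \<open>insert w (e - {v})\<close> that are in \<open>H\<close>, unless \<open>insert w e\<close> is a clique.\<close>

lemma clique_degree_bound:
  fixes k :: nat
  assumes V: "finite V" and H: "H \<subseteq> {e. e \<subseteq> V \<and> card e = k}" and k: "k \<ge> 1" and e: "e \<in> H"
  shows "(\<Sum>s | s \<subseteq> e \<and> card s = k - 1. card {e' \<in> H. s \<subseteq> e'})
          \<le> k + (k - 1) * (card V - k) + card {w \<in> V - e. insert w e \<in> cliques V k H}"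
proof -
  have eV: "e \<subseteq> V" and ce: "card e = k" using H e by auto
  have fe: "finite e" using eV V finite_subset by blast
  have fH: "finite H" by (rule finite_subset[of _ "Pow V"]) (use H V in auto)
  let ?a = "\<lambda>w. card {v \<in> e. insert w (e - {v}) \<in> H}"
  let ?t = "\<lambda>w. if insert w e \<in> cliques V k H then 1 else 0 :: nat"
  \<comment> \<open>The \<open>Suc\<close> counts \<open>e\<close> itself; any other member of
    \<open>H\<close> above \<open>e - {v}\<close> replaces \<open>v\<close> by a vertex
    \<open>w\<close> outside \<open>e\<close>.\<close>
  have deg: "card {e' \<in> H. e - {v} \<subseteq> e'} = Suc (card {w \<in> V - e. insert w (e - {v}) \<in> H})"
    if v: "v \<in> e" for v
  proof -
    let ?W = "{w \<in> V - e. insert w (e - {v}) \<in> H}"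
    have eq: "{e' \<in> H. e - {v} \<subseteq> e'} = insert e ((\<lambda>w. insert w (e - {v})) ` ?W)"
    proof
      show "insert e ((\<lambda>w. insert w (e - {v})) ` ?W) \<subseteq> {e' \<in> H. e - {v} \<subseteq> e'}" using e by auto
      show "{e' \<in> H. e - {v} \<subseteq> e'} \<subseteq> insert e ((\<lambda>w. insert w (e - {v})) ` ?W)"
      proof
        fix e' assume e': "e' \<in> {e' \<in> H. e - {v} \<subseteq> e'}"
        then have e'V: "e' \<subseteq> V" and ce': "card e' = k" using H by auto
        then have fe': "finite e'" using V finite_subset by blast
        have "card (e - {v}) = k - 1" using v fe ce by simp
        then have "card (e' - (e - {v})) = 1"
          using e' ce' k fe by (simp add: card_Diff_subset)
        then obtain w where w: "e' - (e - {v}) = {w}" by (auto simp: card_1_singleton_iff)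
        then have e'w: "e' = insert w (e - {v})" using e' by auto
        show "e' \<in> insert e ((\<lambda>w. insert w (e - {v})) ` ?W)"
        proof (cases "w = v")
          case True then show ?thesis using e'w v by auto
        next
          case False
          then have "w \<notin> e" using w by auto
          then show ?thesis using e'w e' e'V by auto
        qed
      qed
    qed
    have "inj_on (\<lambda>w. insert w (e - {v})) ?W" by (auto simp: inj_on_def)
    moreover have "e \<notin> (\<lambda>w. insert w (e - {v})) ` ?W" by auto
    ultimately show ?thesis unfolding eq using V by (simp add: card_image)
  qed
  have a_le: "?a w \<le> k - 1 + ?t w" if w: "w \<in> V - e" for w
  proof (cases "insert w e \<in> cliques V k H")
    case True
    have "?a w \<le> card e" by (rule card_mono) (use fe in auto)
    then show ?thesis using True ce by simp
  next
    case False
    have "\<exists>v\<in>e. insert w (e - {v}) \<notin> H"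
    proof (rule ccontr)
      assume all: "\<not> ?thesis"
      \<comment> \<open>The k-subsets of \<open>insert w e\<close> are \<open>e\<close>, obtained by
        deleting \<open>w\<close>, and the exchanges \<open>insert w (e - {v})\<close>. If no
        exchange fails, all of them lie in \<open>H\<close>.\<close>
      have "insert w e \<in> cliques V k H" unfolding cliques_def
      proof (intro CollectI conjI allI impI)
        show "insert w e \<subseteq> V" "card (insert w e) = Suc k" using w eV fe ce by auto
        fix e' assume e': "e' \<subseteq> insert w e \<and> card e' = k"
        have "e' \<in> {s. s \<subseteq> insert w e \<and> card s = Suc k - 1}" using e' by simp
        moreover have "(\<lambda>v. insert w e - {v}) ` insert w e = {s. s \<subseteq> insert w e \<and> card s = Suc k - 1}"
          by (rule bij_betw_imp_surj_on[OF card_subsets_one_less]) (use w fe ce in auto)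
        ultimately obtain v where v: "v \<in> insert w e" "e' = insert w e - {v}" by (smt (verit) imageE)
        show "e' \<in> H"
        proof (cases "v = w")
          case True then show ?thesis using v w e by simp
        next
          case False
          then have "e' = insert w (e - {v})" using v by auto
          then show ?thesis using all v False by auto
        qed
      qed
      with False show False by simp
    qed
    then have "{v \<in> e. insert w (e - {v}) \<in> H} \<subset> e" by auto
    then have "?a w < k" using psubset_card_mono[OF fe] ce by metis
    then show ?thesis by simp
  qed
  have "(\<Sum>s | s \<subseteq> e \<and> card s = k - 1. card {e' \<in> H. s \<subseteq> e'}) = (\<Sum>v\<in>e. card {e' \<in> H. e - {v} \<subseteq> e'})"
    by (rule sum.reindex_bij_betw[symmetric, OF card_subsets_one_less[OF fe ce k]])
  also have "\<dots> = k + (\<Sum>v\<in>e. card {w \<in> V - e. insert w (e - {v}) \<in> H})"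
    using deg ce by (simp add: sum_Suc)
  \<comment> \<open>The exchanges are recounted by the incoming vertex \<open>w\<close> instead of
    the outgoing vertex \<open>v\<close>.\<close>
  also have "(\<Sum>v\<in>e. card {w \<in> V - e. insert w (e - {v}) \<in> H}) = (\<Sum>w\<in>V - e. ?a w)"
    by (rule sum_card_incidence) (use fe V in auto)
  also have "\<dots> \<le> (\<Sum>w\<in>V - e. k - 1 + ?t w)" by (rule sum_mono) (use a_le in blast)
  also have "\<dots> = (k - 1) * (card V - k) + card {w \<in> V - e. insert w e \<in> cliques V k H}"
    using V eV fe ce by (simp add: sum.distrib card_Diff_subset sum.If_cases Int_def)
  finally show ?thesis by simp
qed

text \<open>A pair of \<open>e\<close> and \<open>w\<close> is determined by the clique
  \<open>insert w e\<close> with \<open>w\<close> marked, and a clique has k + 1 vertices to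
  mark.\<close>

lemma sum_extension_count_le:
  assumes V: "finite V" and H: "H \<subseteq> {e. e \<subseteq> V \<and> card e = k}"
  shows "(\<Sum>e\<in>H. card {w \<in> V - e. insert w e \<in> cliques V k H}) \<le> Suc k * card (cliques V k H)"
proof -
  have fH: "finite H" by (rule finite_subset[of _ "Pow V"]) (use H V in auto)
  have fQ: "finite (cliques V k H)" by (rule finite_subset[of _ "Pow V"]) (use V in \<open>auto simp: cliques_def\<close>)
  let ?A = "SIGMA e:H. {w \<in> V - e. insert w e \<in> cliques V k H}"
  let ?B = "SIGMA S:cliques V k H. S"
  have fin: "finite S" if "S \<in> cliques V k H" for S
    using that V by (auto simp: cliques_def intro: finite_subset)
  have "(\<Sum>e\<in>H. card {w \<in> V - e. insert w e \<in> cliques V k H}) = card ?A"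
    using fH V by simp
  also have "\<dots> \<le> card ?B"
  proof (rule card_inj_on_le[of "\<lambda>(e, w). (insert w e, w)"])
    show "inj_on (\<lambda>(e, w). (insert w e, w)) ?A"
      by (auto simp: inj_on_def insert_ident)
    show "(\<lambda>(e, w). (insert w e, w)) ` ?A \<subseteq> ?B" by auto
    show "finite ?B" using fQ fin by blast
  qed
  also have "\<dots> = (\<Sum>S\<in>cliques V k H. card S)" using fQ fin by simp
  also have "\<dots> = (\<Sum>S\<in>cliques V k H. Suc k)" by (rule sum.cong) (auto simp: cliques_def)
  finally show ?thesis by (simp add: mult.commute)
qed

text \<open>The sum of the squared degrees of the (k-1)-sets is bounded from below by
  Cauchy-Schwarz, and from above, member by member of \<open>H\<close>, by
  \<open>clique_degree_bound\<close> and \<open>sum_extension_count_le\<close>. For k = 2 this is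
  the Moon-Moser bound on triangles.\<close>

lemma card_cliques_lower_bound:
  fixes k :: nat
  assumes V: "finite V" and H: "H \<subseteq> {e. e \<subseteq> V \<and> card e = k}" and k: "k \<ge> 1" "k \<le> card V"
  shows "(real k)\<^sup>2 / ((real k + 1) * real (card V choose (k - 1))) * (real (card H))\<^sup>2
          - (real (card V) * (real k - 1) - real k * (real k - 2)) / (real k + 1) * real (card H)
         \<le> real (card (cliques V k H))"
proof -
  have fH: "finite H" by (rule finite_subset[of _ "Pow V"]) (use H V in auto)
  define D where "D = {s. s \<subseteq> V \<and> card s = k - 1}"
  define g where "g s = card {e \<in> H. s \<subseteq> e}" for s
  have fD: "finite D" unfolding D_def using V by simp
  have cD: "card D = card V choose (k - 1)" unfolding D_def using n_subsets[OF V] by simp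
  have sub: "{s \<in> D. s \<subseteq> e} = {s. s \<subseteq> e \<and> card s = k - 1}" if "e \<in> H" for e
    using that H by (auto simp: D_def)
  have csub: "card {s \<in> D. s \<subseteq> e} = k" if "e \<in> H" for e
  proof -
    have e: "finite e" "card e = k" using that H finite_subset[OF _ V] by auto
    show ?thesis unfolding sub[OF that] using bij_betw_same_card[OF card_subsets_one_less[OF e k(1)]] e by simp
  qed
  have s1: "(\<Sum>s\<in>D. g s) = k * card H"
    unfolding g_def using sum_card_incidence[OF fD fH, of "(\<subseteq>)"] csub by simp
  \<comment> \<open>One factor \<open>g s\<close> is expanded into a sum over the members above
    \<open>s\<close>; swapping the sums leaves, for each \<open>e\<close>, the degree sum that
    \<open>clique_degree_bound\<close> controls.\<close>
  have "(\<Sum>s\<in>D. g s * g s) = (\<Sum>s\<in>D. \<Sum>e | e \<in> H \<and> s \<subseteq> e. g s)"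
    by (simp add: g_def)
  also have "\<dots> = (\<Sum>e\<in>H. \<Sum>s | s \<in> D \<and> s \<subseteq> e. g s)"
    by (rule sum.swap_restrict) (use fD fH in auto)
  also have "\<dots> \<le> (\<Sum>e\<in>H. k + (k - 1) * (card V - k) + card {w \<in> V - e. insert w e \<in> cliques V k H})"
  proof (rule sum_mono)
    fix e assume e: "e \<in> H"
    show "(\<Sum>s | s \<in> D \<and> s \<subseteq> e. g s)
        \<le> k + (k - 1) * (card V - k) + card {w \<in> V - e. insert w e \<in> cliques V k H}"
      unfolding sub[OF e] g_def by (rule clique_degree_bound[OF V H k(1) e])
  qed
  also have "\<dots> \<le> card H * (k + (k - 1) * (card V - k)) + Suc k * card (cliques V k H)"
    using sum_extension_count_le[OF V H] by (simp add: sum.distrib algebra_simps)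
  finally have s2: "(\<Sum>s\<in>D. g s * g s) \<le> card H * (k + (k - 1) * (card V - k)) + Suc k * card (cliques V k H)" .
  \<comment> \<open>The bounds on \<open>k\<close> make both natural subtractions exact.\<close>
  have eqn: "real (k + (k - 1) * (card V - k)) = real (card V) * (real k - 1) - real k * (real k - 2)"
    unfolding of_nat_add of_nat_mult of_nat_diff[OF k(1)] of_nat_diff[OF k(2)] by (simp add: algebra_simps)
  have cs: "(real k * real (card H))\<^sup>2 \<le> real (card V choose (k - 1)) * (\<Sum>s\<in>D. real (g s) * real (g s))"
    using sum_squared_le_sum_of_squares[of "\<lambda>s. real (g s)" D] s1 cD
    by (simp add: power2_eq_square mult.commute flip: of_nat_sum of_nat_mult)
  have s2': "(\<Sum>s\<in>D. real (g s) * real (g s))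
     \<le> real (card H) * (real (card V) * (real k - 1) - real k * (real k - 2)) + (real k + 1) * real (card (cliques V k H))"
    using s2 unfolding eqn[symmetric] by (simp flip: of_nat_sum of_nat_mult of_nat_add add: algebra_simps)
  have pos: "real (card V choose (k - 1)) > 0" using k by (simp add: zero_less_binomial)
  have "(real k)\<^sup>2 * (real (card H))\<^sup>2 / real (card V choose (k - 1)) \<le> (\<Sum>s\<in>D. real (g s) * real (g s))"
    using cs pos by (simp add: field_simps power_mult_distrib)
  with s2' have "(real k)\<^sup>2 * (real (card H))\<^sup>2 / real (card V choose (k - 1))
       - real (card H) * (real (card V) * (real k - 1) - real k * (real k - 2)) \<le> (real k + 1) * real (card (cliques V k H))"
    by linarith
  then have "((real k)\<^sup>2 * (real (card H))\<^sup>2 / real (card V choose (k - 1))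
       - real (card H) * (real (card V) * (real k - 1) - real k * (real k - 2))) / (real k + 1) \<le> real (card (cliques V k H))"
    by (simp add: pos_divide_le_eq mult.commute add_pos_nonneg)
  then show ?thesis by (subst (asm) diff_divide_distrib) (simp add: mult_ac)
qed

section \<open>Faces of cyclic polytopes\<close>

text \<open>Ranks in a finite linear order increase strictly, so they are distinct and fill the
  whole range. This turns sums over coordinates into sums over exponents.\<close>

lemma bij_betw_card_atMost:
  "bij_betw (\<lambda>i::'m::{finite,linorder}. card {..i}) UNIV {1..CARD('m)}"
proof (rule bij_betw_imageI)
  have less: "card {..i} < card {..j}" if "i < j" for i j :: 'm
  proof (rule psubset_card_mono)
    show "{..i} \<subset> {..j}" using that by (auto simp: psubset_eq)
  qed simp
  show inj: "inj (\<lambda>i::'m. card {..i})"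
  proof (rule injI)
    fix i j :: 'm assume "card {..i} = card {..j}"
    then show "i = j" using less[of i j] less[of j i] by (cases i j rule: linorder_cases) simp_all
  qed
  have "card {..i} \<in> {1..CARD('m)}" for i :: 'm
  proof -
    have "card {..i} \<noteq> 0" by simp
    then have "1 \<le> card {..i}" by linarith
    then show ?thesis using card_mono[of UNIV "{..i}"] by simp
  qed
  then have "range (\<lambda>i::'m. card {..i}) \<subseteq> {1..CARD('m)}" by blast
  moreover have "card (range (\<lambda>i::'m. card {..i})) = card {1..CARD('m)}" by (simp add: card_image[OF inj])
  ultimately show "range (\<lambda>i::'m. card {..i}) = {1..CARD('m)}" by (intro card_subset_eq) simp_all
qed

text \<open>Polynomials of degree at most the dimension are affine functionals restricted to the
  moment curve: the normal vector holds the nonconstant coefficients. Statements about hyperplanes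
  thus become statements about zeros and signs of polynomials.\<close>

lemma poly_eq_inner_moment_curve:
  fixes p :: "real poly"
  assumes "degree p \<le> CARD('m::{finite,linorder})"
  obtains a :: "(real, 'm::{finite,linorder}) vec" where "\<And>t. poly p t = coeff p 0 + a \<bullet> moment_curve t"
proof
  fix t
  have "poly p t = (\<Sum>j\<le>CARD('m). coeff p j * t ^ j)"
    unfolding poly_altdef using assms by (intro sum.mono_neutral_left) (auto simp: coeff_eq_0)
  also have "{..CARD('m)} = insert 0 {1..CARD('m)}" by auto
  also have "(\<Sum>j\<in>insert 0 {1..CARD('m)}. coeff p j * t ^ j) = coeff p 0 + (\<Sum>j\<in>{1..CARD('m)}. coeff p j * t ^ j)"
    by simp
  also have "(\<Sum>j\<in>{1..CARD('m)}. coeff p j * t ^ j) = (\<Sum>i\<in>(UNIV::'m set). coeff p (card {..i}) * t ^ card {..i})"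
    by (rule sum.reindex_bij_betw[symmetric, OF bij_betw_card_atMost])
  also have "\<dots> = (\<chi> i. coeff p (card {..i})) \<bullet> (moment_curve t :: (real, 'm::{finite,linorder}) vec)"
    by (simp add: inner_vec_def moment_curve_def)
  finally show "poly p t = coeff p 0 + (\<chi> i. coeff p (card {..i})) \<bullet> (moment_curve t :: (real, 'm::{finite,linorder}) vec)" .
qed

text \<open>The polynomial X gives a linear functional that recovers \<open>t\<close> from its
  point.\<close>

lemma inj_moment_curve: "inj (moment_curve :: real \<Rightarrow> (real, 'm::{finite,linorder}) vec)"
proof -
  have "degree [:0, 1::real:] \<le> CARD('m)" by (simp add: Suc_le_eq)
  then obtain a :: "(real, 'm::{finite,linorder}) vec" where "\<And>t. poly [:0, 1:] t = coeff [:0, 1:] 0 + a \<bullet> moment_curve t"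
    by (rule poly_eq_inner_moment_curve) blast
  then have "t = a \<bullet> moment_curve t" for t by simp
  then show ?thesis by (metis injI)
qed

text \<open>The polynomial with simple zeros at \<open>S - {s}\<close> has degree at most the
  dimension. Its hyperplane contains all the other points but misses the point of
  \<open>s\<close>.\<close>

lemma affine_independent_moment_curve:
  assumes "finite S" "card S \<le> Suc CARD('m::{finite,linorder})"
  shows "\<not> affine_dependent (moment_curve ` S :: ((real, 'm::{finite,linorder}) vec) set)"
proof
  let ?m = "moment_curve :: real \<Rightarrow> (real, 'm::{finite,linorder}) vec"
  assume "affine_dependent (?m ` S)"
  then obtain s where s: "s \<in> S" "?m s \<in> affine hull (?m ` S - {?m s})"
    by (auto simp: affine_dependent_def)
  define p where "p = (\<Prod>r\<in>S - {s}. [:- r, 1:])"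
  have "degree p \<le> card (S - {s})"
    unfolding p_def using degree_prod_sum_le[of "S - {s}" "\<lambda>r. [:- r, 1:]"] assms(1) by simp
  then have "degree p \<le> CARD('m)" using s(1) assms by simp
  then obtain a :: "(real, 'm::{finite,linorder}) vec" where a: "\<And>t. poly p t = coeff p 0 + a \<bullet> ?m t"
    by (rule poly_eq_inner_moment_curve) blast
  have "affine hull (?m ` S - {?m s}) \<subseteq> {x. a \<bullet> x = - coeff p 0}"
  proof (rule hull_minimal)
    show "?m ` S - {?m s} \<subseteq> {x. a \<bullet> x = - coeff p 0}"
    proof safe
      fix r assume "r \<in> S" "?m r \<noteq> ?m s"
      then have "poly p r = 0" unfolding p_def poly_prod using assms(1) by auto
      then show "a \<bullet> ?m r = - coeff p 0" using a[of r] by simp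
    qed
    show "affine {x. a \<bullet> x = - coeff p 0}" by (rule affine_hyperplane)
  qed
  then have "poly p s = 0" using s(2) a[of s] by auto
  then show False unfolding p_def poly_prod using assms(1) by auto
qed

text \<open>A polynomial that is nonnegative on \<open>T\<close> defines a supporting hyperplane,
  which meets the polytope in the hull of the zeros. The second claim recovers \<open>S\<close> from
  the face, so different zero sets give different faces.\<close>

lemma face_of_cyclic_polytope:
  fixes p :: "real poly"
  assumes "finite T" "degree p \<le> CARD('m::{finite,linorder})"
    and nonneg: "\<And>t. t \<in> T \<Longrightarrow> poly p t \<ge> 0"
    and zeros: "S = {t \<in> T. poly p t = 0}"
  shows "convex hull (moment_curve ` S) face_of (cyclic_polytope T :: ((real, 'm::{finite,linorder}) vec) set)"
    and "{t \<in> T. (moment_curve t :: (real, 'm::{finite,linorder}) vec) \<in> convex hull (moment_curve ` S)} = S"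
proof -
  let ?m = "moment_curve :: real \<Rightarrow> (real, 'm::{finite,linorder}) vec"
  obtain a :: "(real, 'm::{finite,linorder}) vec" where a: "\<And>t. poly p t = coeff p 0 + a \<bullet> ?m t"
    by (rule poly_eq_inner_moment_curve[OF assms(2)]) blast
  define b where "b = - coeff p 0"
  let ?F = "cyclic_polytope T \<inter> {x. a \<bullet> x = b}"
  have face: "?F face_of cyclic_polytope T"
  proof (rule face_of_Int_supporting_hyperplane_ge)
    have "cyclic_polytope T \<subseteq> {x. a \<bullet> x \<ge> b}"
      unfolding cyclic_polytope_def
    proof (rule hull_minimal)
      show "?m ` T \<subseteq> {x. a \<bullet> x \<ge> b}" using nonneg a by (force simp: b_def)
    qed (rule convex_halfspace_ge)
    then show "\<And>x. x \<in> cyclic_polytope T \<Longrightarrow> a \<bullet> x \<ge> b" by auto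
  qed (simp add: cyclic_polytope_def)
  have vert: "?m t \<in> ?F \<longleftrightarrow> t \<in> S" if "t \<in> T" for t
    using that a[of t] hull_inc[of "?m t" "?m ` T" convex] zeros
    by (auto simp: b_def cyclic_polytope_def)
  \<comment> \<open>A face of the hull of finitely many points is the hull of some of them; these
    lie on the hyperplane, so their parameters are zeros.\<close>
  obtain S' where S': "S' \<subseteq> ?m ` T" "?F = convex hull S'"
    using face_of_convex_hull_subset[of "?m ` T" ?F] face assms(1)
    by (auto simp: cyclic_polytope_def finite_imp_compact)
  have "S' \<subseteq> ?m ` S" using S' vert hull_subset[of S' convex] by fastforce
  then have 1: "?F \<subseteq> convex hull (?m ` S)" using S'(2) hull_mono by metis
  have "?m ` S \<subseteq> ?F" using vert zeros by blast
  moreover have "convex ?F" using S'(2) by simp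
  ultimately have "convex hull (?m ` S) \<subseteq> ?F" by (rule hull_minimal)
  with 1 have eq: "convex hull (?m ` S) = ?F" by blast
  show "convex hull (?m ` S) face_of cyclic_polytope T" using face eq by simp
  show "{t \<in> T. ?m t \<in> convex hull (?m ` S)} = S" unfolding eq using vert zeros by blast
qed

lemma card_le_num_cyclic_faces:
  assumes T: "finite T" and k: "k \<le> CARD('m::{finite,linorder})" "Suc k < card T"
    and \<S>: "\<And>S. S \<in> \<S> \<Longrightarrow> card S = Suc k \<and> (\<exists>p. degree p \<le> CARD('m) \<and> (\<forall>t\<in>T. poly p t \<ge> 0) \<and> S = {t \<in> T. poly p t = 0})"
  shows "card \<S> \<le> num_polytope_faces (int k) (cyclic_polytope T :: ((real, 'm::{finite,linorder}) vec) set)"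
proof -
  let ?m = "moment_curve :: real \<Rightarrow> (real, 'm::{finite,linorder}) vec"
  let ?P = "cyclic_polytope T :: ((real, 'm::{finite,linorder}) vec) set"
  let ?f = "\<lambda>S. convex hull (?m ` S)"
  have face: "?f S face_of ?P" and vert: "{t \<in> T. ?m t \<in> ?f S} = S" and sub: "S \<subseteq> T" if S: "S \<in> \<S>" for S
  proof -
    obtain p where p: "degree p \<le> CARD('m)" "\<forall>t\<in>T. poly p t \<ge> 0" "S = {t \<in> T. poly p t = 0}"
      using \<S>[OF S] by blast
    have nonneg: "poly p t \<ge> 0" if "t \<in> T" for t using p(2) that by blast
    show "?f S face_of ?P" by (rule face_of_cyclic_polytope(1)[OF T p(1) nonneg p(3)])
    show "{t \<in> T. ?m t \<in> ?f S} = S" by (rule face_of_cyclic_polytope(2)[OF T p(1) nonneg p(3)])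
    show "S \<subseteq> T" using p(3) by blast
  qed
  have poly: "polytope ?P"
    unfolding cyclic_polytope_def using T by (intro polytope_convex_hull finite_imageI)
  show ?thesis unfolding num_polytope_faces_def
  proof (rule card_inj_on_le[of ?f])
    show "inj_on ?f \<S>" 
    proof (rule inj_onI)
      fix S S' assume S: "S \<in> \<S>" "S' \<in> \<S>" "?f S = ?f S'"
      have "S = {t \<in> T. ?m t \<in> ?f S}" using vert[OF S(1)] by (rule sym)
      also have "\<dots> = S'" unfolding S(3) by (rule vert[OF S(2)])
      finally show "S = S'" .
    qed
    show "finite {F. F face_of ?P \<and> F \<noteq> ?P \<and> aff_dim F = int k}"
      by (rule finite_subset[OF _ finite_polytope_faces[OF poly]]) auto
    show "?f ` \<S> \<subseteq> {F. F face_of ?P \<and> F \<noteq> ?P \<and> aff_dim F = int k}"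
    proof safe
      fix S assume S: "S \<in> \<S>"
      have cS: "card S = Suc k" using \<S>[OF S] by blast
      have fS: "finite S" using cS by (intro card_ge_0_finite) simp
      show "?f S face_of ?P" using face[OF S] .
      have "card (?m ` S) = Suc k"
        using card_image[OF inj_on_subset[OF inj_moment_curve subset_UNIV], of S] cS by (rule trans)
      moreover have "\<not> affine_dependent (?m ` S)"
        using affine_independent_moment_curve[OF fS] cS k by simp
      ultimately show "aff_dim (?f S) = int k"
        using aff_dim_affine_independent[of "?m ` S"] by (simp add: aff_dim_convex_hull)
      \<comment> \<open>Properness: otherwise every parameter would be a zero and \<open>S\<close>
        would equal \<open>T\<close>, which has more than k + 1 elements.\<close>
      assume "?f S = ?P"
      then have "T \<subseteq> {t \<in> T. ?m t \<in> ?f S}" by (auto simp: cyclic_polytope_def intro: hull_inc)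
      then have "S = T" using vert[OF S] sub[OF S] by blast
      then show False using cS k by simp
    qed
  qed
qed

section \<open>Nonnegative polynomials with prescribed zeros\<close>

text \<open>Each remaining zero is added as a double zero, which preserves signs and costs two
  degrees. Degrees are saved by the zeros \<open>A\<close> of \<open>q\<close> that can stay
  simple.\<close>

lemma supporting_poly_extend:
  fixes q :: "real poly"
  assumes "finite T" "S \<subseteq> T" "A \<subseteq> S" "\<And>t. t \<in> T \<Longrightarrow> poly q t \<ge> 0" "A = {t \<in> T. poly q t = 0}"
    and "degree q + 2 * card (S - A) \<le> D"
  shows "\<exists>p::real poly. degree p \<le> D \<and> (\<forall>t\<in>T. poly p t \<ge> 0) \<and> S = {t \<in> T. poly p t = 0}"
proof (intro exI conjI)
  let ?r = "\<Prod>s\<in>S - A. [:- s, 1:] ^ 2"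
  have fS: "finite (S - A)" using assms finite_subset by blast
  have "degree ?r \<le> (\<Sum>s\<in>S - A. degree ([:- s, 1:] ^ 2))" by (rule degree_prod_sum_le[OF fS, unfolded o_def])
  also have "\<dots> \<le> (\<Sum>s\<in>S - A. 2)" by (rule sum_mono) (simp add: degree_power_eq)
  finally have "degree ?r \<le> 2 * card (S - A)" by simp
  then show "degree (q * ?r) \<le> D" using degree_mult_le[of q ?r] assms(6) by linarith
  have r: "poly ?r t = (\<Prod>s\<in>S - A. (t - s)\<^sup>2)" for t by (simp add: poly_prod)
  show "\<forall>t\<in>T. poly (q * ?r) t \<ge> 0" unfolding poly_mult r using assms(4) by (simp add: prod_nonneg)
  have "(\<Prod>s\<in>S - A. (t - s)\<^sup>2) = 0 \<longleftrightarrow> t \<in> S - A" for t using fS by auto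
  then show "S = {t \<in> T. poly (q * ?r) t = 0}" unfolding poly_mult r mult_eq_0_iff using assms(2,3,5) by blast
qed

section \<open>Index sets without consecutive elements\<close>

text \<open>These will contain the index sets for which no degree can be saved. The offset
  \<open>a\<close> allows the first index to be excluded.\<close>

definition sparse_subsets :: "nat \<Rightarrow> nat \<Rightarrow> nat \<Rightarrow> nat set set" where
  "sparse_subsets a N m = {I. I \<subseteq> {a..<a + N} \<and> card I = m \<and> (\<forall>i\<in>I. Suc i \<notin> I)}"

lemma finite_sparse_subsets: "finite (sparse_subsets a N m)"
  by (rule finite_subset[of _ "Pow {a..<a + N}"]) (auto simp: sparse_subsets_def)

text \<open>Pascal's rule in disguise: a sparse set either avoids the last index of the interval, or
  contains it and avoids the one before. The second case shortens the interval by two, hence the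
  two-step induction.\<close>

lemma card_sparse_subsets_le: "card (sparse_subsets a N m) \<le> (Suc N - m) choose m"
proof (induction N arbitrary: m rule: induct_nat_012)
  case 0
  have "sparse_subsets a 0 m = (if m = 0 then {{}} else {})" by (auto simp: sparse_subsets_def)
  then show ?case by simp
next
  case 1
  have "sparse_subsets a (Suc 0) m \<subseteq> (if m = 0 then {{}} else if m = 1 then {{a}} else {})"
  proof
    fix I assume "I \<in> sparse_subsets a (Suc 0) m"
    then have "I = {} \<or> I = {a}" "card I = m" by (auto simp: sparse_subsets_def)
    then show "I \<in> (if m = 0 then {{}} else if m = 1 then {{a}} else {})" by auto
  qed
  then have "card (sparse_subsets a (Suc 0) m) \<le> card (if m = 0 then {{}} else if m = 1 then {{a}} else {})"
    by (intro card_mono) auto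
  then show ?case by (auto split: if_splits)
next
  case (ge2 N)
  show ?case
  proof (cases m)
    case 0
    have "sparse_subsets a (Suc (Suc N)) m \<subseteq> {{}}"
    proof
      fix I assume I: "I \<in> sparse_subsets a (Suc (Suc N)) m"
      then have "finite I" by (auto simp: sparse_subsets_def intro: finite_subset)
      then show "I \<in> {{}}" using I 0 by (simp add: sparse_subsets_def)
    qed
    then have "card (sparse_subsets a (Suc (Suc N)) m) \<le> 1"
      using card_mono[of "{{}}" "sparse_subsets a (Suc (Suc N)) m"] by simp
    then show ?thesis using 0 by simp
  next
    case (Suc l)
    have "sparse_subsets a (Suc (Suc N)) (Suc l)
      \<subseteq> sparse_subsets a (Suc N) (Suc l) \<union> insert (a + Suc N) ` sparse_subsets a N l"
    proof
      fix I assume I: "I \<in> sparse_subsets a (Suc (Suc N)) (Suc l)"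
      then have I': "I \<subseteq> {a..<a + Suc (Suc N)}" "card I = Suc l" "\<forall>i\<in>I. Suc i \<notin> I"
        by (simp_all add: sparse_subsets_def)
      have fI: "finite I" by (rule finite_subset[OF I'(1)]) simp
      show "I \<in> sparse_subsets a (Suc N) (Suc l) \<union> insert (a + Suc N) ` sparse_subsets a N l"
      proof (cases "a + Suc N \<in> I")
        case True
        have aN: "a + N \<notin> I" using I'(3) True by auto
        have "I - {a + Suc N} \<subseteq> {a..<a + N}"
        proof
          fix i assume i: "i \<in> I - {a + Suc N}"
          then have "i \<noteq> a + N" "i \<noteq> a + Suc N" "i \<in> {a..<a + Suc (Suc N)}" using aN I'(1) by blast+
          then show "i \<in> {a..<a + N}" by auto
        qed
        then have "I - {a + Suc N} \<in> sparse_subsets a N l"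
          unfolding sparse_subsets_def using I' fI True by simp
        moreover have "I = insert (a + Suc N) (I - {a + Suc N})" using True by blast
        ultimately show ?thesis by blast
      next
        case False
        have "I \<subseteq> {a..<a + Suc N}"
        proof
          fix i assume i: "i \<in> I"
          then have "i \<noteq> a + Suc N" "i \<in> {a..<a + Suc (Suc N)}" using False I'(1) by blast+
          then show "i \<in> {a..<a + Suc N}" by auto
        qed
        then show ?thesis unfolding sparse_subsets_def using I' by simp
      qed
    qed
    then have "card (sparse_subsets a (Suc (Suc N)) (Suc l))
      \<le> card (sparse_subsets a (Suc N) (Suc l) \<union> insert (a + Suc N) ` sparse_subsets a N l)"
      by (intro card_mono) (auto simp: finite_sparse_subsets)
    also have "\<dots> \<le> card (sparse_subsets a (Suc N) (Suc l)) + card (sparse_subsets a N l)"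
      by (rule order_trans[OF card_Un_le]) (simp add: card_image_le finite_sparse_subsets)
    also have "\<dots> \<le> ((Suc (Suc N) - Suc l) choose Suc l) + ((Suc N - l) choose l)"
      using ge2 by (intro add_mono)
    also have "\<dots> \<le> (Suc (Suc (Suc N)) - m) choose m"
    \<comment> \<open>Beyond this range truncated subtraction gives 0 on top of both binomials, with
      a positive number below, so both vanish.\<close>
    proof (cases "l \<le> Suc N")
      case True
      then have "Suc (Suc (Suc N)) - m = Suc (Suc N - l)" using Suc by simp
      then show ?thesis using Suc by simp
    qed (simp add: Suc)
    finally show ?thesis using Suc by simp
  qed
qed

section \<open>Supporting polynomials for index sets of ordered parameters\<close>

lemma finite_set_enumeration:
  fixes T :: "real set"
  assumes "finite T" "card T = n"
  obtains x where "strict_mono_on {..<n} x" "x ` {..<n} = T"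
proof
  let ?x = "\<lambda>i. sorted_list_of_set T ! i"
  show "strict_mono_on {..<n} ?x"
    using sorted_wrt_nth_less[OF strict_sorted_list_of_set[of T]] assms by (auto simp: strict_mono_on_def)
  show "?x ` {..<n} = T"
    using nth_image[of n "sorted_list_of_set T"] assms by (simp add: lessThan_atLeast0)
qed

text \<open>Transfers \<open>supporting_poly_extend\<close> to positions in an enumeration of the
  parameters; \<open>K\<close> holds the positions of the zeros of \<open>q\<close>.\<close>

lemma supporting_poly_index:
  fixes x :: "nat \<Rightarrow> real" and q :: "real poly"
  assumes x: "inj_on x {..<n}" and I: "I \<subseteq> {..<n}" and K: "K \<subseteq> I"
    and nonneg: "\<And>j. j < n \<Longrightarrow> poly q (x j) \<ge> 0"
    and zeros: "\<And>j. j < n \<Longrightarrow> poly q (x j) = 0 \<longleftrightarrow> j \<in> K"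
    and D: "degree q + 2 * (card I - card K) \<le> D"
  shows "\<exists>p::real poly. degree p \<le> D \<and> (\<forall>t\<in>x ` {..<n}. poly p t \<ge> 0) \<and> x ` I = {t \<in> x ` {..<n}. poly p t = 0}"
proof (rule supporting_poly_extend[where A = "x ` K" and q = q])
  have K': "K \<subseteq> {..<n}" using I K by (rule order_trans[rotated])
  then have fK: "finite K" by (rule finite_subset) simp
  have "x ` (I - K) = x ` I - x ` K"
    by (rule inj_on_image_set_diff[OF x _ K']) (use I in blast)
  then have "card (x ` I - x ` K) = card (x ` (I - K))" by simp
  also have "\<dots> = card (I - K)"
    by (rule card_image) (rule inj_on_subset[OF x], use I in blast)
  also have "\<dots> = card I - card K" by (rule card_Diff_subset[OF fK K])
  finally have "card (x ` I - x ` K) = card I - card K" .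
  then show "degree q + 2 * card (x ` I - x ` K) \<le> D" using D by presburger
  show "x ` K = {t \<in> x ` {..<n}. poly q t = 0}"
  proof
    show "x ` K \<subseteq> {t \<in> x ` {..<n}. poly q t = 0}"
    proof
      fix t assume "t \<in> x ` K"
      then obtain j where j: "t = x j" "j \<in> K" by blast
      then have "j < n" using K' by auto
      then show "t \<in> {t \<in> x ` {..<n}. poly q t = 0}" using j zeros[of j] by simp
    qed
    show "{t \<in> x ` {..<n}. poly q t = 0} \<subseteq> x ` K"
    proof
      fix t assume "t \<in> {t \<in> x ` {..<n}. poly q t = 0}"
      then obtain j where "t = x j" "j < n" "poly q (x j) = 0" by auto
      then show "t \<in> x ` K" using zeros[of j] by simp
    qed
  qed
  show "x ` I \<subseteq> x ` {..<n}" by (rule image_mono[OF I])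
  show "x ` K \<subseteq> x ` I" by (rule image_mono[OF K])
  show "poly q t \<ge> 0" if t: "t \<in> x ` {..<n}" for t
  proof -
    obtain j where "t = x j" "j < n" using t by auto
    then show ?thesis using nonneg[of j] by simp
  qed
qed simp

text \<open>A quadratic with zeros at two neighbouring parameters is negative only strictly between
  them, where no parameter lies. Two simple zeros replace two double ones, so the degree is 2 + 2(k
  - 1) = 2k.\<close>

lemma supporting_poly_consecutive:
  fixes x :: "nat \<Rightarrow> real"
  assumes x: "strict_mono_on {..<n} x" and I: "I \<subseteq> {..<n}" "card I = Suc k" and i: "i \<in> I" "Suc i \<in> I"
    and D: "2 * k \<le> D"
  shows "\<exists>p::real poly. degree p \<le> D \<and> (\<forall>t\<in>x ` {..<n}. poly p t \<ge> 0) \<and> x ` I = {t \<in> x ` {..<n}. poly p t = 0}"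
proof (rule supporting_poly_index[where q = "[:- x i, 1:] * [:- x (Suc i), 1:]"])
  let ?q = "[:- x i, 1:] * [:- x (Suc i), 1:]"
  show inj: "inj_on x {..<n}" by (rule strict_mono_on_imp_inj_on[OF x])
  show "poly ?q (x j) \<ge> 0" if "j < n" for j
  proof -
    consider "j \<le> i" | "Suc i \<le> j" by linarith
    then show ?thesis
    proof cases
      case 1
      then have "x j \<le> x i" "x j \<le> x (Suc i)"
        using strict_mono_on_leD[OF x, of j] that i I by auto
      then show ?thesis unfolding poly_mult by (intro mult_nonpos_nonpos) auto
    next
      case 2
      then have "x i \<le> x j" "x (Suc i) \<le> x j"
        using strict_mono_on_leD[OF x, of _ j] that i I by auto
      then show ?thesis unfolding poly_mult by (intro mult_nonneg_nonneg) auto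
    qed
  qed
  show "poly ?q (x j) = 0 \<longleftrightarrow> j \<in> {i, Suc i}" if "j < n" for j
    unfolding poly_mult mult_eq_0_iff using inj_onD[OF inj, of j] that i I by auto
  have fI: "finite I" by (rule finite_subset[OF I(1)]) simp
  have "card {i, Suc i} \<le> card I" using i fI by (intro card_mono) auto
  then show "degree ?q + 2 * (card I - card {i, Suc i}) \<le> D"
    using D I degree_mult_le[of "[:- x i, 1:]" "[:- x (Suc i), 1:]"] by simp
qed (use I i in auto)

text \<open>No parameter lies to the left of the first one, so a simple zero there keeps its sign
  and saves one degree. The last parameter is treated symmetrically.\<close>

lemma supporting_poly_first:
  fixes x :: "nat \<Rightarrow> real"
  assumes x: "strict_mono_on {..<n} x" and I: "I \<subseteq> {..<n}" "card I = Suc k" and i: "0 \<in> I"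
    and D: "2 * k + 1 \<le> D"
  shows "\<exists>p::real poly. degree p \<le> D \<and> (\<forall>t\<in>x ` {..<n}. poly p t \<ge> 0) \<and> x ` I = {t \<in> x ` {..<n}. poly p t = 0}"
proof (rule supporting_poly_index[where q = "[:- x 0, 1:]"])
  let ?q = "[:- x 0, 1:]"
  show inj: "inj_on x {..<n}" by (rule strict_mono_on_imp_inj_on[OF x])
  show "poly ?q (x j) \<ge> 0" if "j < n" for j
    using strict_mono_on_leD[OF x, of 0 j] that by simp
  show "poly ?q (x j) = 0 \<longleftrightarrow> j \<in> {0}" if "j < n" for j
    using inj_onD[OF inj, of j 0] that by auto
  show "degree ?q + 2 * (card I - card {0::nat}) \<le> D" using D I by simp
qed (use I i in auto)

lemma supporting_poly_last:
  fixes x :: "nat \<Rightarrow> real"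
  assumes x: "strict_mono_on {..<n} x" and I: "I \<subseteq> {..<n}" "card I = Suc k" and i: "n - 1 \<in> I"
    and D: "2 * k + 1 \<le> D"
  shows "\<exists>p::real poly. degree p \<le> D \<and> (\<forall>t\<in>x ` {..<n}. poly p t \<ge> 0) \<and> x ` I = {t \<in> x ` {..<n}. poly p t = 0}"
proof (rule supporting_poly_index[where q = "[:x (n - 1), - 1:]"])
  let ?q = "[:x (n - 1), - 1:]"
  show inj: "inj_on x {..<n}" by (rule strict_mono_on_imp_inj_on[OF x])
  show "poly ?q (x j) \<ge> 0" if "j < n" for j
    using strict_mono_on_leD[OF x, of j "n - 1"] that by simp
  show "poly ?q (x j) = 0 \<longleftrightarrow> j \<in> {n - 1}" if "j < n" for j
    using inj_onD[OF inj, of j "n - 1"] that by auto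
  show "degree ?q + 2 * (card I - card {n - 1}) \<le> D" using D I by simp
qed (use I i in auto)

text \<open>The cyclically consecutive pair: the quadratic is nonnegative between its zeros, and all
  parameters lie there. With \<open>n \<ge> 2\<close> the two ends differ, so two degrees are
  saved.\<close>

lemma supporting_poly_first_last:
  fixes x :: "nat \<Rightarrow> real"
  assumes x: "strict_mono_on {..<n} x" and I: "I \<subseteq> {..<n}" "card I = Suc k" and i: "0 \<in> I" "n - 1 \<in> I"
    and n: "n \<ge> 2" and D: "2 * k \<le> D"
  shows "\<exists>p::real poly. degree p \<le> D \<and> (\<forall>t\<in>x ` {..<n}. poly p t \<ge> 0) \<and> x ` I = {t \<in> x ` {..<n}. poly p t = 0}"
proof (rule supporting_poly_index[where q = "[:- x 0, 1:] * [:x (n - 1), - 1:]"])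
  let ?q = "[:- x 0, 1:] * [:x (n - 1), - 1:]"
  show inj: "inj_on x {..<n}" by (rule strict_mono_on_imp_inj_on[OF x])
  show "poly ?q (x j) \<ge> 0" if "j < n" for j
    unfolding poly_mult using strict_mono_on_leD[OF x, of 0 j] strict_mono_on_leD[OF x, of j "n - 1"] that
    by (intro mult_nonneg_nonneg) auto
  show "poly ?q (x j) = 0 \<longleftrightarrow> j \<in> {0, n - 1}" if "j < n" for j
    unfolding poly_mult mult_eq_0_iff using inj_onD[OF inj, of j 0] inj_onD[OF inj, of j "n - 1"] that by auto
  have fI: "finite I" by (rule finite_subset[OF I(1)]) simp
  have c: "card {0, n - 1} = 2" using n by simp
  have "card {0, n - 1} \<le> card I" using i fI by (intro card_mono) auto
  then show "degree ?q + 2 * (card I - card {0, n - 1}) \<le> D"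
    unfolding c using D I degree_mult_le[of "[:- x 0, 1:]" "[:x (n - 1), - 1:]"] by simp
qed (use I i in auto)

section \<open>Counting the faces of the cyclic polytope\<close>

text \<open>\<open>\<B>\<close> is a set of possible exceptions; every other index set yields its
  own k-face. The assumption ranges over all \<open>x\<close> because the enumeration of
  \<open>T\<close> is chosen inside the proof.\<close>

lemma num_cyclic_faces_ge:
  assumes T: "finite T" "card T = n" and k: "k \<le> CARD('m::{finite,linorder})" "Suc k < n"
    and \<B>: "\<And>x I. strict_mono_on {..<n} x \<Longrightarrow> I \<subseteq> {..<n} \<Longrightarrow> card I = Suc k \<Longrightarrow> I \<notin> \<B> \<Longrightarrow>
      \<exists>p::real poly. degree p \<le> CARD('m) \<and> (\<forall>t\<in>x ` {..<n}. poly p t \<ge> 0) \<and> x ` I = {t \<in> x ` {..<n}. poly p t = 0}"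
    and fin: "finite \<B>"
  shows "n choose Suc k \<le> num_polytope_faces (int k) (cyclic_polytope T :: ((real, 'm::{finite,linorder}) vec) set) + card \<B>"
proof -
  obtain x where x: "strict_mono_on {..<n} x" "x ` {..<n} = T"
    by (rule finite_set_enumeration[OF T]) blast
  have inj: "inj_on x {..<n}" by (rule strict_mono_on_imp_inj_on[OF x(1)])
  define \<A> where "\<A> = {I. I \<subseteq> {..<n} \<and> card I = Suc k}"
  have f\<A>: "finite \<A>" by (simp add: \<A>_def)
  have "n choose Suc k = card \<A>" using n_subsets[of "{..<n}" "Suc k"] by (simp add: \<A>_def)
  also have "\<dots> \<le> card ((\<A> - \<B>) \<union> \<B>)" using f\<A> fin by (intro card_mono) auto
  also have "\<dots> \<le> card (\<A> - \<B>) + card \<B>" by (rule card_Un_le)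
  also have "card (\<A> - \<B>) = card ((`) x ` (\<A> - \<B>))"
    by (rule card_image[symmetric], rule inj_on_subset[OF inj_on_image_Pow[OF inj]]) (auto simp: \<A>_def)
  also have "\<dots> \<le> num_polytope_faces (int k) (cyclic_polytope T :: ((real, 'm::{finite,linorder}) vec) set)"
  proof (rule card_le_num_cyclic_faces)
    fix S assume "S \<in> (`) x ` (\<A> - \<B>)"
    then obtain I where I: "S = x ` I" "I \<subseteq> {..<n}" "card I = Suc k" "I \<notin> \<B>" by (auto simp: \<A>_def)
    have "card S = Suc k" unfolding I(1) using I(3) card_image[OF inj_on_subset[OF inj I(2)]] by simp
    then show "card S = Suc k \<and> (\<exists>p. degree p \<le> CARD('m) \<and> (\<forall>t\<in>T. poly p t \<ge> 0) \<and> S = {t \<in> T. poly p t = 0})"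
      using \<B>[OF x(1) I(2-4)] unfolding I(1) x(2) by simp
  qed (use T k in auto)
  finally show ?thesis by simp
qed

text \<open>Two degrees must be saved, so an exceptional set has no cyclically consecutive pair.
  Either it avoids \<open>n - 1\<close>, or it contains \<open>n - 1\<close> and avoids both
  neighbours \<open>0\<close> and \<open>n - 2\<close>, leaving k sparse indices from 1 to n -
  3.\<close>

lemma num_faces_cyclic_polytope_even:
  assumes T: "finite T" "card T = n" and m: "CARD('m::{finite,linorder}) = 2 * k" "n = Suc (2 * k + m)" and k: "k \<ge> 1"
  shows "real (n choose Suc k) - (real ((m + (k + 1)) choose (k + 1)) - real ((m + (k - 1)) choose (k - 1)))
    \<le> real (num_polytope_faces (int k) (cyclic_polytope T :: ((real, 'm::{finite,linorder}) vec) set))"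
proof -
  let ?f = "num_polytope_faces (int k) (cyclic_polytope T :: ((real, 'm::{finite,linorder}) vec) set)"
  let ?B1 = "sparse_subsets 0 (n - 1) (Suc k)"
  let ?B2 = "insert (n - 1) ` sparse_subsets 1 (n - 3) k"
  have n: "n \<ge> 3" using m k by simp
  have "n choose Suc k \<le> ?f + card (?B1 \<union> ?B2)"
  proof (rule num_cyclic_faces_ge[OF T])
    fix x :: "nat \<Rightarrow> real" and I
    assume x: "strict_mono_on {..<n} x" and I: "I \<subseteq> {..<n}" "card I = Suc k" "I \<notin> ?B1 \<union> ?B2"
    have fI: "finite I" by (rule finite_subset[OF I(1)]) simp
    have "(\<exists>i. i \<in> I \<and> Suc i \<in> I) \<or> 0 \<in> I \<and> n - 1 \<in> I"
    proof (rule ccontr)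
      assume *: "\<not> ?thesis"
      show False
      proof (cases "n - 1 \<in> I")
        case True
        have "Suc (n - 2) = n - 1" using n by simp
        then have n2: "n - 2 \<notin> I" using * True by force
        have "I - {n - 1} \<subseteq> {1..<1 + (n - 3)}"
        proof
          fix j assume j: "j \<in> I - {n - 1}"
          have "0 \<notin> I" using * True by simp
          then have "j \<noteq> 0" using j by (metis DiffD1)
          moreover have "j \<noteq> n - 2" using j n2 by (metis DiffD1)
          moreover have "j < n" "j \<noteq> n - 1" using j I(1) by auto
          ultimately show "j \<in> {1..<1 + (n - 3)}" by simp
        qed
        moreover have "card (I - {n - 1}) = k" using fI True I(2) by simp
        moreover have "\<forall>i\<in>I - {n - 1}. Suc i \<notin> I - {n - 1}" using * by blast
        ultimately have "I - {n - 1} \<in> sparse_subsets 1 (n - 3) k" unfolding sparse_subsets_def by blast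
        moreover have "I = insert (n - 1) (I - {n - 1})" using True by blast
        ultimately show False using I(3) by blast
      next
        case False
        have "I \<subseteq> {0..<0 + (n - 1)}"
        proof
          fix j assume j: "j \<in> I"
          have "j \<noteq> n - 1" using j False by blast
          moreover have "j < n" using j I(1) by auto
          ultimately show "j \<in> {0..<0 + (n - 1)}" by simp
        qed
        moreover have "\<forall>i\<in>I. Suc i \<notin> I" using * by blast
        ultimately have "I \<in> ?B1" unfolding sparse_subsets_def using I(2) by blast
        then show False using I(3) by blast
      qed
    qed
    then show "\<exists>p::real poly. degree p \<le> CARD('m) \<and> (\<forall>t\<in>x ` {..<n}. poly p t \<ge> 0) \<and> x ` I = {t \<in> x ` {..<n}. poly p t = 0}"
    proof (elim disjE exE conjE)
      show ?thesis if "i \<in> I" "Suc i \<in> I" for i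
        by (rule supporting_poly_consecutive[OF x I(1,2) that]) (simp add: m)
      show ?thesis if "0 \<in> I" "n - 1 \<in> I"
        by (rule supporting_poly_first_last[OF x I(1,2) that]) (use n m in simp_all)
    qed
  next
    show "k \<le> CARD('m)" "Suc k < n" using m k by linarith+
  qed (simp add: finite_sparse_subsets)
  moreover have "card (?B1 \<union> ?B2) \<le> card ?B1 + card (sparse_subsets 1 (n - 3) k)"
    by (rule order_trans[OF card_Un_le]) (simp add: card_image_le finite_sparse_subsets)
  moreover have "card ?B1 + card (sparse_subsets 1 (n - 3) k) \<le> ((m + k) choose Suc k) + ((m + (k - 1)) choose k)"
  proof (rule add_mono)
    have "Suc (n - 1) - Suc k = m + k" "Suc (n - 3) - k = m + (k - 1)" using m(2) k by simp_all
    then show "card ?B1 \<le> (m + k) choose Suc k" "card (sparse_subsets 1 (n - 3) k) \<le> (m + (k - 1)) choose k"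
      using card_sparse_subsets_le[of 0 "n - 1" "Suc k"] card_sparse_subsets_le[of 1 "n - 3" k] by simp_all
  qed
  ultimately have "n choose Suc k \<le> ?f + (((m + k) choose Suc k) + ((m + (k - 1)) choose k))" by linarith
  \<comment> \<open>Pascal's rule, applied twice, brings the count into the form of a difference of
    h-numbers.\<close>
  moreover have "(m + (k + 1)) choose (k + 1)
      = ((m + (k - 1)) choose (k - 1)) + ((m + (k - 1)) choose k) + ((m + k) choose Suc k)"
    using k by (cases k) simp_all
  ultimately show ?thesis by linarith
qed

text \<open>One saved degree suffices, so an exceptional set avoids both ends as well as consecutive
  pairs: it is sparse in the range from 1 to n - 2.\<close>

lemma num_faces_cyclic_polytope_odd:
  assumes T: "finite T" "card T = n" and m: "CARD('m::{finite,linorder}) = 2 * k + 1" "n = Suc (2 * k + 1 + m)"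
  shows "real (n choose Suc k) - (real ((m + (k + 1)) choose (k + 1)) - real ((m + k) choose k))
    \<le> real (num_polytope_faces (int k) (cyclic_polytope T :: ((real, 'm::{finite,linorder}) vec) set))"
proof -
  let ?f = "num_polytope_faces (int k) (cyclic_polytope T :: ((real, 'm::{finite,linorder}) vec) set)"
  let ?B = "sparse_subsets 1 (n - 2) (Suc k)"
  have "n choose Suc k \<le> ?f + card ?B"
  proof (rule num_cyclic_faces_ge[OF T])
    fix x :: "nat \<Rightarrow> real" and I
    assume x: "strict_mono_on {..<n} x" and I: "I \<subseteq> {..<n}" "card I = Suc k" "I \<notin> ?B"
    have "(\<exists>i. i \<in> I \<and> Suc i \<in> I) \<or> 0 \<in> I \<or> n - 1 \<in> I"
    proof (rule ccontr)
      assume *: "\<not> ?thesis"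
      have "I \<subseteq> {1..<1 + (n - 2)}"
      proof
        fix j assume j: "j \<in> I"
        have "0 \<notin> I" "n - 1 \<notin> I" using * by simp_all
        then have "j \<noteq> 0" "j \<noteq> n - 1" using j by metis+
        moreover have "j < n" using j I(1) by auto
        ultimately show "j \<in> {1..<1 + (n - 2)}" by simp
      qed
      moreover have "\<forall>i\<in>I. Suc i \<notin> I" using * by blast
      ultimately have "I \<in> ?B" unfolding sparse_subsets_def using I(2) by blast
      then show False using I(3) by blast
    qed
    then show "\<exists>p::real poly. degree p \<le> CARD('m) \<and> (\<forall>t\<in>x ` {..<n}. poly p t \<ge> 0) \<and> x ` I = {t \<in> x ` {..<n}. poly p t = 0}"
    proof (elim disjE exE conjE)
      show ?thesis if "i \<in> I" "Suc i \<in> I" for i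
        by (rule supporting_poly_consecutive[OF x I(1,2) that]) (simp add: m)
      show ?thesis if "0 \<in> I"
        by (rule supporting_poly_first[OF x I(1,2) that]) (simp add: m)
      show ?thesis if "n - 1 \<in> I"
        by (rule supporting_poly_last[OF x I(1,2) that]) (simp add: m)
    qed
  next
    show "k \<le> CARD('m)" "Suc k < n" using m by linarith+
  qed (rule finite_sparse_subsets)
  moreover have "card ?B \<le> (m + k) choose Suc k"
  proof -
    have "Suc (n - 2) - Suc k = m + k" using m(2) by simp
    then show ?thesis using card_sparse_subsets_le[of 1 "n - 2" "Suc k"] by simp
  qed
  ultimately have "n choose Suc k \<le> ?f + ((m + k) choose Suc k)" by linarith
  moreover have "(m + (k + 1)) choose (k + 1) = ((m + k) choose k) + ((m + k) choose Suc k)" by simp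
  ultimately show ?thesis by linarith
qed

section \<open>Dehn--Sommerville relations\<close>

unbundle no vec_syntax
unbundle fps_syntax

text \<open>The binomial theorem before grouping by cardinality: each subset records where
  \<open>a\<close> is chosen in the product of the factors \<open>a + b\<close>.\<close>

lemma sum_Pow_power_mult_power:
  fixes a b :: "'a::comm_ring_1"
  assumes "finite A"
  shows "(\<Sum>B\<in>Pow A. a ^ card B * b ^ (card A - card B)) = (a + b) ^ card A"
proof -
  have "(\<Sum>B\<in>Pow A. a ^ card B * b ^ (card A - card B)) = (\<Sum>B\<in>Pow A. (\<Prod>x\<in>B. a) * (\<Prod>x\<in>A - B. b))"
    by (rule sum.cong) (use assms in \<open>auto simp: card_Diff_subset finite_subset\<close>)
  also have "\<dots> = (\<Prod>x\<in>A. a + b)" using prod_add[OF assms, of "\<lambda>_. a" "\<lambda>_. b"] by simp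
  finally show ?thesis by simp
qed

lemma fps_one_minus_X_power_nth:
  "((1 - fps_X :: 'a::comm_ring_1 fps) ^ N) $ j = (-1) ^ j * of_nat (N choose j)"
proof (induction N arbitrary: j)
  case 0
  then show ?case by (cases j) auto
next
  case (Suc N)
  have "((1 - fps_X :: 'a fps) ^ Suc N) $ j = ((1 - fps_X :: 'a fps) ^ N) $ j - (fps_X * (1 - fps_X :: 'a fps) ^ N) $ j"
    by (simp add: algebra_simps)
  then show ?case using Suc by (cases j) (auto simp: algebra_simps)
qed

text \<open>The expansion of the inverse of \<open>(1 - fps_X) ^ Suc m\<close>. Multiplication by
  \<open>1 - fps_X\<close> takes differences of coefficients, and Pascal's rule lowers
  \<open>m\<close> by one.\<close>

lemma fps_negative_binomial:
  "(1 - fps_X) ^ Suc m * Abs_fps (\<lambda>j. of_nat ((m + j) choose j)) = (1 :: 'a::comm_ring_1 fps)"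
proof (induction m)
  case 0
  show ?case
  proof (rule fps_ext)
    fix j
    show "((1 - fps_X) ^ Suc 0 * Abs_fps (\<lambda>j. of_nat ((0 + j) choose j)) :: 'a fps) $ j = 1 $ j"
      by (cases j) (auto simp: algebra_simps)
  qed
next
  case (Suc m)
  have step: "(1 - fps_X) * Abs_fps (\<lambda>j. of_nat ((Suc m + j) choose j)) = (Abs_fps (\<lambda>j. of_nat ((m + j) choose j)) :: 'a fps)"
  proof (rule fps_ext)
    fix j
    show "((1 - fps_X) * Abs_fps (\<lambda>j. of_nat ((Suc m + j) choose j)) :: 'a fps) $ j = Abs_fps (\<lambda>j. of_nat ((m + j) choose j)) $ j"
      by (cases j) (auto simp: algebra_simps)
  qed
  show ?case unfolding power_Suc2[of _ "Suc m"] mult.assoc step by (rule Suc)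
qed

section \<open>Alternating sums over Eulerian complexes\<close>

lemma reduced_euler_char_eq:
  assumes "finite X" "X \<noteq> {}"
  shows "reduced_euler_char X = - (\<Sum>G\<in>X. (-1) ^ card G)"
proof -
  have "reduced_euler_char X = (\<Sum>i = -1..complex_dim X. \<Sum>G | G \<in> X \<and> face_dim G = i. (-1) powi face_dim G)"
    unfolding reduced_euler_char_def num_faces_def by (intro sum.cong) auto
  also have "\<dots> = (\<Sum>G\<in>X. (-1) powi face_dim G)"
    by (rule sum.group) (use assms in \<open>auto simp: complex_dim_def face_dim_def intro: Max_ge\<close>)
  also have "\<dots> = (\<Sum>G\<in>X. - ((-1) ^ card G))"
    by (intro sum.cong) (auto simp: face_dim_def power_int_diff)
  finally show ?thesis by (simp add: sum_negf)
qed

lemma simplicial_complex_finite: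
  assumes "simplicial_complex V \<Delta>"
  shows "finite \<Delta>" and "G \<in> \<Delta> \<Longrightarrow> finite G"
  using assms unfolding simplicial_complex_def
  by (meson finite_Pow_iff finite_subset, meson PowD finite_subset subsetD)

lemma card_face_le:
  assumes "simplicial_complex V \<Delta>" "complex_dim \<Delta> = int d - 1" "G \<in> \<Delta>"
  shows "card G \<le> d"
proof -
  have "face_dim G \<le> complex_dim \<Delta>"
    unfolding complex_dim_def using simplicial_complex_finite(1)[OF assms(1)] assms(3) by simp
  then show ?thesis using assms(2) by (simp add: face_dim_def)
qed

text \<open>Adding \<open>F\<close> maps the link bijectively onto the faces above \<open>F\<close>
  and multiplies signs by \<open>(-1) ^ card F\<close>. This cancels the dependence on
  \<open>F\<close> in the Eulerian condition.\<close>

lemma eulerian_sum_superfaces: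
  assumes sc: "simplicial_complex V \<Delta>" and dim: "complex_dim \<Delta> = int d - 1" and "eulerian \<Delta>"
    and F: "F \<in> \<Delta>"
  shows "(\<Sum>G | G \<in> \<Delta> \<and> F \<subseteq> G. (-1) ^ card G :: real) = (-1) ^ d"
proof -
  have sub: "\<And>G H. G \<in> \<Delta> \<Longrightarrow> H \<subseteq> G \<Longrightarrow> H \<in> \<Delta>" using sc by (auto simp: simplicial_complex_def)
  have "{} \<in> face_link F \<Delta>" using F sub[of F "{}"] by (auto simp: face_link_def)
  moreover have "finite (face_link F \<Delta>)"
    using simplicial_complex_finite(1)[OF sc] by (auto simp: face_link_def)
  ultimately have "(\<Sum>G\<in>face_link F \<Delta>. (-1) ^ card G) = - reduced_euler_char (face_link F \<Delta>)"
    by (subst reduced_euler_char_eq) auto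
  also have "\<dots> = - ((-1) powi (int d - int (card F) - 1))"
    using assms(3) F dim by (simp add: eulerian_def face_dim_def)
  finally have link: "(\<Sum>G\<in>face_link F \<Delta>. (-1) ^ card G) = - ((-1 :: real) powi (int d - int (card F) - 1))" .
  have "bij_betw (\<lambda>\<sigma>. \<sigma> \<union> F) (face_link F \<Delta>) {G \<in> \<Delta>. F \<subseteq> G}"
    by (rule bij_betwI[where g = "\<lambda>G. G - F"]) (auto simp: face_link_def intro: sub dest: sub simp: Un_absorb2 Diff_subset)
  then have "(\<Sum>G | G \<in> \<Delta> \<and> F \<subseteq> G. (-1) ^ card G :: real) = (\<Sum>\<sigma>\<in>face_link F \<Delta>. (-1) ^ card (\<sigma> \<union> F))"
    by (rule sum.reindex_bij_betw[symmetric])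
  also have "\<dots> = (\<Sum>\<sigma>\<in>face_link F \<Delta>. (-1) ^ card F * (-1) ^ card \<sigma>)"
    by (intro sum.cong)
       (use F in \<open>auto simp: face_link_def card_Un_disjoint simplicial_complex_finite(2)[OF sc] power_add\<close>)
  also have "\<dots> = (-1) ^ card F * - ((-1) powi (int d - int (card F) - 1))"
    using link by (simp flip: sum_distrib_left)
  also have "\<dots> = (-1) ^ d" by (simp add: power_int_diff)
  finally show ?thesis .
qed

text \<open>Some face has \<open>d\<close> vertices. If there were no further vertex, the complex
  would be a full simplex, whose alternating sum is 0 and not \<open>(-1) ^ d\<close>.\<close>

lemma eulerian_dim_less_card:
  assumes sc: "simplicial_complex V \<Delta>" and dim: "complex_dim \<Delta> = int d - 1" and eu: "eulerian \<Delta>"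
    and d: "d \<ge> 1"
  shows "d < card V"
proof -
  have V: "finite V" "\<Delta> \<subseteq> Pow V" "\<Delta> \<noteq> {}" "\<And>G H. G \<in> \<Delta> \<Longrightarrow> H \<subseteq> G \<Longrightarrow> H \<in> \<Delta>"
    using sc by (auto simp: simplicial_complex_def)
  have "complex_dim \<Delta> \<in> face_dim ` \<Delta>"
    unfolding complex_dim_def using V simplicial_complex_finite(1)[OF sc] by (intro Max_in) auto
  then obtain G where G: "G \<in> \<Delta>" "card G = d" using dim by (auto simp: face_dim_def)
  have "card G \<le> card V" using G V by (intro card_mono) auto
  moreover have "card V \<noteq> d"
  proof
    assume *: "card V = d"
    then have "G = V" using G V by (intro card_subset_eq) auto
    then have "\<Delta> = Pow V" using G V by auto
    then have "(\<Sum>G\<in>Pow V. (-1) ^ card G :: real) = (-1) ^ d"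
      using eulerian_sum_superfaces[OF sc dim eu, of "{}"] by (simp add: Pow_def)
    moreover have "(\<Sum>G\<in>Pow V. (-1) ^ card G :: real) = 0"
      using sum_Pow_power_mult_power[OF V(1), of "-1::real" 1] * d by (simp add: power_0_left)
    ultimately show False by simp
  qed
  ultimately show ?thesis using G by simp
qed

section \<open>The h-polynomial and its symmetry\<close>

text \<open>The h-polynomial, summed face by face. As a power series it can be multiplied by inverse
  powers of \<open>1 - fps_X\<close>.\<close>

definition h_series :: "nat \<Rightarrow> 'v set set \<Rightarrow> real fps" where
  "h_series d \<Delta> = (\<Sum>G\<in>\<Delta>. fps_X ^ card G * (1 - fps_X) ^ (d - card G))"

text \<open>The right-hand side is the reversed \<open>h\<close>-polynomial.\<close>

lemma h_series_eq_reversed: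
  assumes sc: "simplicial_complex V \<Delta>" and dim: "complex_dim \<Delta> = int d - 1" and eu: "eulerian \<Delta>"
  shows "h_series d \<Delta> = (\<Sum>F\<in>\<Delta>. (-1) ^ (d + card F) * (1 - fps_X) ^ (d - card F))"
proof -
  have fin: "finite \<Delta>" by (rule simplicial_complex_finite(1)[OF sc])
  have sub: "\<And>G H. G \<in> \<Delta> \<Longrightarrow> H \<subseteq> G \<Longrightarrow> H \<in> \<Delta>" using sc by (auto simp: simplicial_complex_def)
  have sign: "(-1) ^ a = fps_const ((-1) ^ a :: real)" for a :: nat
    by (cases "even a") (simp_all flip: fps_const_neg)
  \<comment> \<open>The Eulerian condition enters here: the constant sign becomes a sum over
    superfaces, so that the order of summation over \<open>F\<close> and \<open>G\<close> can be
    exchanged.\<close>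
  have euler: "(-1) ^ d = (\<Sum>G | G \<in> \<Delta> \<and> F \<subseteq> G. (-1) ^ card G :: real fps)" if "F \<in> \<Delta>" for F
    unfolding sign eulerian_sum_superfaces[OF sc dim eu that, symmetric]
    by (rule fps_ext) (simp add: fps_sum_nth)
  \<comment> \<open>All subsets of \<open>G\<close> are faces, so the binomial theorem applies with
    summands \<open>-1\<close> and \<open>1 - fps_X\<close>, which add up to
    \<open>- fps_X\<close>.\<close>
  have inner: "(\<Sum>F | F \<in> \<Delta> \<and> F \<subseteq> G. (-1) ^ card F * (1 - fps_X) ^ (d - card F))
      = (1 - fps_X) ^ (d - card G) * (- fps_X :: real fps) ^ card G" if G: "G \<in> \<Delta>" for G
  proof -
    have fG: "finite G" and cG: "card G \<le> d"
      using simplicial_complex_finite(2)[OF sc G] card_face_le[OF sc dim G] .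
    have "{F. F \<in> \<Delta> \<and> F \<subseteq> G} = Pow G" using sub[OF G] by auto
    then have "(\<Sum>F | F \<in> \<Delta> \<and> F \<subseteq> G. (-1) ^ card F * (1 - fps_X :: real fps) ^ (d - card F))
      = (\<Sum>F\<in>Pow G. (1 - fps_X) ^ (d - card G) * ((-1) ^ card F * (1 - fps_X) ^ (card G - card F)))"
    proof (intro sum.cong)
      fix F assume "F \<in> Pow G"
      then have "card F \<le> card G" using fG card_mono by blast
      then have "d - card F = (d - card G) + (card G - card F)" using cG by simp
      then show "(-1) ^ card F * (1 - fps_X :: real fps) ^ (d - card F)
         = (1 - fps_X) ^ (d - card G) * ((-1) ^ card F * (1 - fps_X) ^ (card G - card F))"
        by (simp add: power_add)
    qed
    also have "\<dots> = (1 - fps_X) ^ (d - card G) * (- fps_X) ^ card G"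
      unfolding sum_distrib_left[symmetric] sum_Pow_power_mult_power[OF fG] by simp
    finally show ?thesis .
  qed
  have "(\<Sum>F\<in>\<Delta>. (-1) ^ (d + card F) * (1 - fps_X :: real fps) ^ (d - card F))
     = (\<Sum>F\<in>\<Delta>. \<Sum>G | G \<in> \<Delta> \<and> F \<subseteq> G. (-1) ^ card G * ((-1) ^ card F * (1 - fps_X) ^ (d - card F)))"
  proof (rule sum.cong)
    fix F assume F: "F \<in> \<Delta>"
    show "(-1) ^ (d + card F) * (1 - fps_X :: real fps) ^ (d - card F)
      = (\<Sum>G | G \<in> \<Delta> \<and> F \<subseteq> G. (-1) ^ card G * ((-1) ^ card F * (1 - fps_X) ^ (d - card F)))"
      unfolding power_add euler[OF F] mult.assoc sum_distrib_right by (rule refl)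
  qed simp
  also have "\<dots> = (\<Sum>G\<in>\<Delta>. \<Sum>F | F \<in> \<Delta> \<and> F \<subseteq> G. (-1) ^ card G * ((-1) ^ card F * (1 - fps_X) ^ (d - card F)))"
    by (rule sum.swap_restrict[OF fin fin])
  also have "\<dots> = (\<Sum>G\<in>\<Delta>. (-1) ^ card G * ((1 - fps_X) ^ (d - card G) * (- fps_X) ^ card G))"
    by (rule sum.cong) (simp_all add: inner flip: sum_distrib_left)
  also have "\<dots> = (\<Sum>G\<in>\<Delta>. fps_X ^ card G * (1 - fps_X) ^ (d - card G))"
  proof (rule sum.cong)
    fix G assume "G \<in> \<Delta>"
    have "(-1) ^ card G * ((1 - fps_X) ^ (d - card G) * (- fps_X) ^ card G)
      = ((-1) * (- fps_X :: real fps)) ^ card G * (1 - fps_X) ^ (d - card G)"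
      unfolding power_mult_distrib by (simp only: mult_ac)
    then show "(-1) ^ card G * ((1 - fps_X) ^ (d - card G) * (- fps_X) ^ card G)
      = fps_X ^ card G * (1 - fps_X :: real fps) ^ (d - card G)" by simp
  qed simp
  finally show ?thesis by (simp add: h_series_def)
qed

text \<open>After \<open>h_series_eq_reversed\<close> the symmetry holds face by face, by symmetry
  of the binomial coefficients.\<close>

lemma Dehn_Sommerville:
  assumes sc: "simplicial_complex V \<Delta>" and dim: "complex_dim \<Delta> = int d - 1" and eu: "eulerian \<Delta>"
    and j: "j \<le> d"
  shows "h_series d \<Delta> $ j = h_series d \<Delta> $ (d - j)"
proof -
  have const: "((-1) ^ a * f) $ i = (-1) ^ a * f $ i" for a i and f :: "real fps"
    by (cases "even a") auto
  have "h_series d \<Delta> $ j = (\<Sum>F\<in>\<Delta>. ((-1) ^ (d + card F) * (1 - fps_X :: real fps) ^ (d - card F)) $ j)"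
    unfolding h_series_eq_reversed[OF sc dim eu] by (simp add: fps_sum_nth)
  also have "\<dots> = (\<Sum>F\<in>\<Delta>. (fps_X ^ card F * (1 - fps_X) ^ (d - card F)) $ (d - j))"
  proof (rule sum.cong)
    fix F assume "F \<in> \<Delta>"
    then have F: "card F \<le> d" using card_face_le[OF sc dim] by blast
    show "((-1) ^ (d + card F) * (1 - fps_X :: real fps) ^ (d - card F)) $ j
        = (fps_X ^ card F * (1 - fps_X) ^ (d - card F)) $ (d - j)"
    \<comment> \<open>In the first case both coefficients vanish: one by the shift by
      \<open>card F\<close>, the other because \<open>j\<close> exceeds the exponent.\<close>
    proof (cases "d - j < card F")
      case True
      then have "d - card F < j" using F j by simp
      then show ?thesis using True by (simp add: const fps_X_power_mult_nth fps_one_minus_X_power_nth)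
    next
      case False
      define N where "N = d - card F"
      have N: "d + card F = N + 2 * card F" "d - card F = N" "d - j - card F = N - j" and le: "j \<le> N"
        using False F j by (auto simp: N_def)
      have "(-1::real) ^ (N + 2 * card F) * (-1) ^ j = (-1) ^ (N - j)"
        using le by (simp add: power_add power_mult power_diff_conv_inverse)
      moreover have "N choose (N - j) = N choose j" using binomial_symmetric[OF le] by simp
      ultimately show ?thesis
        unfolding const fps_X_power_mult_nth fps_one_minus_X_power_nth N mult.assoc[symmetric]
        using False by simp
    qed
  qed simp
  finally show ?thesis by (simp add: h_series_def fps_sum_nth)
qed

text \<open>Summing \<open>X ^ card G * (1 - X) ^ (card V - card G)\<close> over all subsets of \<open>V\<close> gives \<open>1\<close>, so the
  \<open>h\<close>-polynomial differs from \<open>(1 - X) ^ (d - card V)\<close> only by the contributions of the nonfaces,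
  all of which are large for a neighborly complex.\<close>

lemma h_series_via_nonfaces:
  assumes sc: "simplicial_complex V \<Delta>" and dim: "complex_dim \<Delta> = int d - 1" and n: "card V = Suc (d + m)"
  shows "h_series d \<Delta> $ j = real ((m + j) choose j) -
    (\<Sum>G\<in>Pow V - \<Delta>. if j < card G then 0
       else ((1 - fps_X) ^ (card V - card G) * Abs_fps (\<lambda>j. real ((m + j) choose j))) $ (j - card G))"
proof -
  let ?W = "Abs_fps (\<lambda>j. real ((m + j) choose j))"
  let ?t = "\<lambda>G::'a set. fps_X ^ card G * (1 - fps_X :: real fps) ^ (card V - card G)"
  have V: "finite V" "\<Delta> \<subseteq> Pow V" using sc by (auto simp: simplicial_complex_def)
  have W: "(1 - fps_X) ^ Suc m * ?W = 1" using fps_negative_binomial[where ?'a = real] by simp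
  have "h_series d \<Delta> = h_series d \<Delta> * ((1 - fps_X) ^ Suc m * ?W)" using W by simp
  also have "\<dots> = (h_series d \<Delta> * (1 - fps_X) ^ Suc m) * ?W" by (simp only: mult.assoc)
  \<comment> \<open>The factor raises the exponent \<open>d - card G\<close> to
    \<open>card V - card G\<close>, so the faces contribute part of the binomial sum over
    \<open>Pow V\<close>.\<close>
  also have "h_series d \<Delta> * (1 - fps_X) ^ Suc m = (\<Sum>G\<in>\<Delta>. ?t G)"
    unfolding h_series_def sum_distrib_right
  proof (rule sum.cong)
    fix G assume "G \<in> \<Delta>"
    then have "card V - card G = (d - card G) + Suc m" using card_face_le[OF sc dim] n by fastforce
    then show "fps_X ^ card G * (1 - fps_X) ^ (d - card G) * (1 - fps_X) ^ Suc m = ?t G"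
      by (simp only: power_add mult.assoc)
  qed simp
  also have "\<dots> = (\<Sum>G\<in>Pow V. ?t G) - (\<Sum>G\<in>Pow V - \<Delta>. ?t G)"
    using sum.subset_diff[OF V(2), of ?t] V(1) by simp
  also have "(\<Sum>G\<in>Pow V. ?t G) = 1" using sum_Pow_power_mult_power[OF V(1), of "fps_X :: real fps" "1 - fps_X"] by simp
  finally have "h_series d \<Delta> = ?W - (\<Sum>G\<in>Pow V - \<Delta>. fps_X ^ card G * ((1 - fps_X) ^ (card V - card G) * ?W))"
    by (simp add: left_diff_distrib sum_distrib_right mult.assoc)
  then show ?thesis by (simp add: fps_sum_nth fps_X_power_mult_nth)
qed

text \<open>With no nonface below size k, the h-numbers are \<open>H j\<close> for j < k,
  \<open>H k - \<delta>\<close> at k, and \<open>H (k + 1) + (d - k) * \<delta> - \<nu>\<close> at k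
  + 1. Equating the last with its mirror image at d - k - 1 yields \<open>\<nu>\<close>.\<close>

lemma nonfaces_of_eulerian:
  fixes k d m :: nat
  assumes sc: "simplicial_complex V \<Delta>" and dim: "complex_dim \<Delta> = int d - 1" and eu: "eulerian \<Delta>"
    and n: "card V = Suc (d + m)" and k: "k \<ge> 1" and d: "d = 2 * k \<or> d = 2 * k + 1"
    and small: "\<forall>G\<subseteq>V. card G < k \<longrightarrow> G \<in> \<Delta>"
  defines "\<delta> \<equiv> real (card {G \<in> Pow V - \<Delta>. card G = k})"
  defines "\<nu> \<equiv> real (card {G \<in> Pow V - \<Delta>. card G = Suc k})"
  defines "H \<equiv> (\<lambda>j. real ((m + j) choose j))"
  shows "d = 2 * k \<Longrightarrow> \<nu> = H (k + 1) - H (k - 1) + real k * \<delta>"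
    and "d = 2 * k + 1 \<Longrightarrow> \<nu> = H (k + 1) - H k + real (k + 2) * \<delta>"
proof -
  have V: "finite V" using sc by (auto simp: simplicial_complex_def)
  let ?N = "Pow V - \<Delta>"
  let ?h = "h_series d \<Delta>"
  let ?c = "\<lambda>j G. if j < card G then 0
       else ((1 - fps_X) ^ (card V - card G) * Abs_fps H) $ (j - card G)"
  have h: "?h $ j = H j - (\<Sum>G\<in>?N. ?c j G)" for j
    unfolding H_def by (rule h_series_via_nonfaces[OF sc dim n])
  have fN: "finite ?N" using V by simp
  have large: "card G \<ge> k" if "G \<in> ?N" for G using small that by (meson DiffD1 DiffD2 PowD not_less)
  have kn: "real (card V - k) = real d + real m + 1 - real k" using d n by auto
  have h1: "?h $ j = H j" if "j < k" for j
  proof -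
    have "?c j G = 0" if "G \<in> ?N" for G
    proof -
      have "j < card G" using large[OF that] \<open>j < k\<close> by linarith
      then show ?thesis by simp
    qed
    then have "(\<Sum>G\<in>?N. ?c j G) = 0" by (intro sum.neutral ballI)
    then show ?thesis using h by simp
  qed
  have "(\<Sum>G\<in>?N. ?c k G) = (\<Sum>G\<in>?N. if card G = k then 1 else 0)"
  proof (rule sum.cong)
    fix G assume "G \<in> ?N"
    then show "?c k G = (if card G = k then 1 else 0)" using large[of G]
      by (cases "card G = k") (simp_all add: H_def fps_one_minus_X_power_nth)
  qed simp
  then have h2: "?h $ k = H k - \<delta>" using fN h[of k] by (simp add: \<delta>_def sum.If_cases Int_def)
  \<comment> \<open>A nonface of size k contributes a linear coefficient, (m + 1) - (n - k) = k - d
    with n = \<open>card V\<close>; one of size k + 1 contributes the constant coefficient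
    1.\<close>
  have "(\<Sum>G\<in>?N. ?c (Suc k) G) = (\<Sum>G\<in>?N. (if card G = k then - (real d - real k) else 0) + (if card G = Suc k then 1 else 0))"
  proof (rule sum.cong)
    fix G assume G: "G \<in> ?N"
    consider "card G = k" | "card G = Suc k" | "card G > Suc k" using large[OF G] by linarith
    then show "?c (Suc k) G = (if card G = k then - (real d - real k) else 0) + (if card G = Suc k then 1 else 0)"
    proof cases
      case 1
      then show ?thesis by (simp add: H_def fps_one_minus_X_power_nth kn)
    qed (simp_all add: H_def fps_one_minus_X_power_nth)
  qed simp
  then have h3: "?h $ (Suc k) = H (Suc k) + (real d - real k) * \<delta> - \<nu>"
    using fN h[of "Suc k"]
    by (simp add: \<delta>_def \<nu>_def sum.distrib sum.If_cases Int_def) (simp add: algebra_simps)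
  show "\<nu> = H (k + 1) - H (k - 1) + real k * \<delta>" if "d = 2 * k"
  proof -
    have "d - Suc k = k - 1" using that by simp
    then have "?h $ (Suc k) = ?h $ (k - 1)"
      using Dehn_Sommerville[OF sc dim eu, of "Suc k"] k that by simp
    then show ?thesis using h1[of "k - 1"] h3 k that by simp
  qed
  show "\<nu> = H (k + 1) - H k + real (k + 2) * \<delta>" if "d = 2 * k + 1"
  proof -
    have "d - Suc k = k" using that by simp
    then have "?h $ (Suc k) = ?h $ k"
      using Dehn_Sommerville[OF sc dim eu, of "Suc k"] k that by simp
    then show ?thesis using h2 h3 that by (simp add: algebra_simps)
  qed
qed

section \<open>Missing faces\<close>

text \<open>Every proper subset of a clique lies in one of its k-subsets and is a face by closure;
  membership in the complex then separates the two kinds.\<close>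

lemma num_missing_faces_add_num_faces:
  assumes sc: "simplicial_complex V \<Delta>"
  shows "num_missing_faces (int k) V \<Delta> + num_faces (int k) \<Delta> = card (cliques V k {F \<in> \<Delta>. card F = k})"
proof -
  let ?M = "{S. missing_face V \<Delta> S \<and> face_dim S = int k}"
  let ?F = "{F \<in> \<Delta>. face_dim F = int k}"
  have V: "finite V" "\<Delta> \<subseteq> Pow V" "\<And>G H. G \<in> \<Delta> \<Longrightarrow> H \<subseteq> G \<Longrightarrow> H \<in> \<Delta>"
    using sc by (auto simp: simplicial_complex_def)
  have dim: "face_dim S = int k \<longleftrightarrow> card S = Suc k" for S :: "'a set" by (auto simp: face_dim_def)
  have "cliques V k {F \<in> \<Delta>. card F = k} = ?M \<union> ?F"
  proof (intro equalityI subsetI)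
    fix S assume "S \<in> cliques V k {F \<in> \<Delta>. card F = k}"
    then have S: "S \<subseteq> V" "card S = Suc k" "\<And>e. e \<subseteq> S \<Longrightarrow> card e = k \<Longrightarrow> e \<in> \<Delta>"
      by (auto simp: cliques_def)
    have fS: "finite S" by (rule finite_subset[OF S(1) V(1)])
    have "G \<in> \<Delta>" if G: "G \<subset> S" for G
    proof -
      obtain v where v: "v \<in> S" "v \<notin> G" using G by blast
      have "S - {v} \<in> \<Delta>" using S(2) v fS by (intro S(3)) auto
      then show ?thesis by (rule V(3)) (use G v in blast)
    qed
    then show "S \<in> ?M \<union> ?F" using S(1,2) by (cases "S \<in> \<Delta>") (simp_all add: missing_face_def dim)
  next
    fix S assume S: "S \<in> ?M \<union> ?F"
    then have c: "card S = Suc k" "S \<subseteq> V" using V(2) by (auto simp: dim missing_face_def)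
    have "e \<in> \<Delta>" if e: "e \<subseteq> S" "card e = k" for e
    proof -
      have "e \<noteq> S" using e c by auto
      then have "e \<subset> S" using e by blast
      then show ?thesis using S V(3)[of S e] by (auto simp: missing_face_def)
    qed
    then show "S \<in> cliques V k {F \<in> \<Delta>. card F = k}" using c by (simp add: cliques_def)
  qed
  moreover have "?M \<inter> ?F = {}" by (auto simp: missing_face_def)
  moreover have "finite ?M" by (rule finite_subset[of _ "Pow V"]) (use V in \<open>auto simp: missing_face_def\<close>)
  moreover have "finite ?F" using simplicial_complex_finite(1)[OF sc] by simp
  ultimately show ?thesis
    unfolding num_missing_faces_def num_faces_def by (simp add: card_Un_disjoint)
qed

lemma num_faces_add_card_nonfaces:
  assumes sc: "simplicial_complex V \<Delta>"
  shows "num_faces (int j - 1) \<Delta> + card {G \<in> Pow V - \<Delta>. card G = j} = card V choose j"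
proof -
  have V: "finite V" "\<Delta> \<subseteq> Pow V" using sc by (auto simp: simplicial_complex_def)
  have eq: "num_faces (int j - 1) \<Delta> = card {G \<in> \<Delta>. card G = j}"
    by (simp add: num_faces_def face_dim_def)
  have "card V choose j = card {G. G \<subseteq> V \<and> card G = j}" using n_subsets[OF V(1)] by simp
  also have "{G. G \<subseteq> V \<and> card G = j} = {G \<in> \<Delta>. card G = j} \<union> {G \<in> Pow V - \<Delta>. card G = j}"
    using V(2) by blast
  also have "card \<dots> = card {G \<in> \<Delta>. card G = j} + card {G \<in> Pow V - \<Delta>. card G = j}"
    by (rule card_Un_disjoint) (use V simplicial_complex_finite(1)[OF sc] in auto)
  finally show ?thesis using eq by simp
qed

text \<open>Neighborliness leaves no nonface of size \<open>i\<close>. Since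
  \<open>i \<le> card V\<close>, a smaller set can be filled up to size \<open>i\<close> and
  inherits facehood by closure.\<close>

lemma neighborly_imp_face:
  assumes sc: "simplicial_complex V \<Delta>" and nb: "neighborly i \<Delta>"
    and G: "G \<subseteq> V" "card G \<le> i" and i: "i \<le> card V"
  shows "G \<in> \<Delta>"
proof -
  have V: "finite V" "\<Delta> \<subseteq> Pow V" "\<And>G H. G \<in> \<Delta> \<Longrightarrow> H \<subseteq> G \<Longrightarrow> H \<in> \<Delta>" "\<And>v. v \<in> V \<Longrightarrow> {v} \<in> \<Delta>"
    using sc by (auto simp: simplicial_complex_def)
  have "{S \<in> Pow V - \<Delta>. card S = 1} = {}" using V(4) by (auto simp: card_1_singleton_iff)
  then have "card {S \<in> Pow V - \<Delta>. card S = 1} = 0" by (simp only: card.empty)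
  then have "num_faces 0 \<Delta> = card V"
    using num_faces_add_card_nonfaces[OF sc, of 1] by (simp only: of_nat_1 diff_self add_0_right choose_one)
  then have "card {S \<in> Pow V - \<Delta>. card S = i} = 0"
    using num_faces_add_card_nonfaces[OF sc, of i] nb by (simp add: neighborly_def)
  then have all: "S \<in> \<Delta>" if "S \<subseteq> V" "card S = i" for S using V(1) that by auto
  have fG: "finite G" by (rule finite_subset[OF G(1) V(1)])
  have "i - card G \<le> card (V - G)" using i G(1) fG by (simp add: card_Diff_subset)
  then obtain W where W: "W \<subseteq> V - G" "card W = i - card G" "finite W"
    by (rule obtain_subset_with_card_n)
  have "card (G \<union> W) = card G + card W" by (rule card_Un_disjoint) (use W fG in auto)
  then have "G \<union> W \<in> \<Delta>" using W G by (intro all) auto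
  then show ?thesis by (rule V(3)) blast
qed

theorem corollary5p4:
  fixes k d n :: nat
    and V :: "'v set" and \<Delta> :: "'v set set"
    and T :: "real set"
  assumes "k \<ge> 2"
    and "d \<in> {2 * k, 2 * k + 1}"
    and "simplicial_complex V \<Delta>"
    and "card V = n"
    and "complex_dim \<Delta> = int d - 1"
    and "eulerian \<Delta>"
    and "nearly_neighborly \<Delta>"
    and "CARD('m::{finite,linorder}) = d"
    and "finite T" and "card T = n"
  shows "real (num_missing_faces (int k) V \<Delta>) \<ge>
      (real k)\<^sup>2 / ((real k + 1) * real (n choose (k - 1))) *
        (real (num_faces (int k - 1) \<Delta>))\<^sup>2
      - (real n * (real k - 1) - real k * (real k - 2)) / (real k + 1) *
        real (num_faces (int k - 1) \<Delta>)
      - real (num_polytope_faces (int k) (cyclic_polytope T :: (real ^ ('m::{finite,linorder})) set))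
      + (real (d div 2) + 1 + (-1) ^ (d - 1)) *
        (real (n choose k) - real (num_faces (int k - 1) \<Delta>))"
proof -
  note sc = assms(3) and dim = assms(5) and eu = assms(6)
  have V: "finite V" "\<Delta> \<subseteq> Pow V" using sc by (auto simp: simplicial_complex_def)
  have d: "d = 2 * k \<or> d = 2 * k + 1" using assms(2) by simp
  have "d < card V" by (rule eulerian_dim_less_card[OF sc dim eu]) (use d assms(1) in linarith)
  \<comment> \<open>\<open>m\<close> is the excess n - d - 1, shared by the h-numbers and the cyclic
    polytope bounds.\<close>
  then obtain m where m: "card V = Suc (d + m)" using less_imp_Suc_add by blast
  have k: "k \<ge> 1" "k \<le> card V" using assms(1) d m by linarith+
  define \<delta> where "\<delta> = real (card {G \<in> Pow V - \<Delta>. card G = k})"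
  define \<nu> where "\<nu> = real (card {G \<in> Pow V - \<Delta>. card G = Suc k})"
  define H where "H j = real ((m + j) choose j)" for j
  let ?C = "real (num_polytope_faces (int k) (cyclic_polytope T :: (real ^ ('m::{finite,linorder})) set))"
  let ?c = "real (d div 2) + 1 + (-1) ^ (d - 1)"
  have "nat (complex_dim \<Delta> + 1) div 2 - 1 = k - 1" using d dim by auto
  then have nb: "neighborly (k - 1) \<Delta>" using assms(7) by (simp add: nearly_neighborly_def)
  have small: "\<forall>G\<subseteq>V. card G < k \<longrightarrow> G \<in> \<Delta>"
  proof (intro allI impI)
    fix G assume G: "G \<subseteq> V" "card G < k"
    show "G \<in> \<Delta>" by (rule neighborly_imp_face[OF sc nb G(1)]) (use G(2) k in linarith)+
  qed
  note ds = nonfaces_of_eulerian[OF sc dim eu m k(1) d small, folded \<delta>_def \<nu>_def H_def]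
  \<comment> \<open>\<open>n choose Suc k\<close> minus \<open>\<nu>\<close> is the number of
    k-faces. The defect \<open>\<nu> - ?c * \<delta>\<close> depends only on k, d and n and matches
    the cyclic bound; \<open>?c\<close> is k for even d, where the sign cancels the 1, and k + 2 for
    odd d.\<close>
  have key: "real (n choose Suc k) - \<nu> + ?c * \<delta> \<le> ?C"
    using d
  proof
    assume e: "d = 2 * k"
    have "odd (d - 1)" using e k by simp
    then have c: "?c = real k" using e by simp
    have "real (n choose Suc k) - (H (k + 1) - H (k - 1)) \<le> ?C"
      unfolding H_def by (rule num_faces_cyclic_polytope_even[OF assms(9,10)]) (use assms e m k in simp_all)
    then show ?thesis unfolding c using ds(1)[OF e] by linarith
  next
    assume e: "d = 2 * k + 1"
    have c: "?c = real (k + 2)" using e by simp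
    have "real (n choose Suc k) - (H (k + 1) - H k) \<le> ?C"
      unfolding H_def by (rule num_faces_cyclic_polytope_odd[OF assms(9,10)]) (use assms e m in simp_all)
    then show ?thesis unfolding c using ds(2)[OF e] by linarith
  qed
  have f: "real (num_faces (int k - 1) \<Delta>) + \<delta> = real (n choose k)"
    using num_faces_add_card_nonfaces[OF sc, of k] assms(4) by (simp add: \<delta>_def flip: of_nat_add)
  have f': "real (num_faces (int k) \<Delta>) + \<nu> = real (n choose Suc k)"
    using num_faces_add_card_nonfaces[OF sc, of "Suc k"] assms(4) by (simp add: \<nu>_def flip: of_nat_add)
  have fk: "num_faces (int k - 1) \<Delta> = card {F \<in> \<Delta>. card F = k}"
    by (simp add: num_faces_def face_dim_def)
  have "real (card (cliques V k {F \<in> \<Delta>. card F = k})) \<ge>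
      (real k)\<^sup>2 / ((real k + 1) * real (n choose (k - 1))) * (real (num_faces (int k - 1) \<Delta>))\<^sup>2
      - (real n * (real k - 1) - real k * (real k - 2)) / (real k + 1) * real (num_faces (int k - 1) \<Delta>)"
    unfolding fk assms(4)[symmetric] by (rule card_cliques_lower_bound[OF V(1) _ k]) (use V(2) in blast)
  moreover have "real (num_missing_faces (int k) V \<Delta>) + real (num_faces (int k) \<Delta>)
      = real (card (cliques V k {F \<in> \<Delta>. card F = k}))"
    using num_missing_faces_add_num_faces[OF sc, of k] by (simp flip: of_nat_add)
  moreover have "real (n choose k) - real (num_faces (int k - 1) \<Delta>) = \<delta>" using f by simp
  ultimately show ?thesis using key f' by simp
qed

end
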